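(* Let $\mu$ be a finite absolutely continuous measure in $\mathbb{R}^d$, and let $P$ be a multicenter partition of $\mu$ with $t$ centers. Every hyperplane misses the interior of at least $t$ regions.
   Context: A measure $\mu$ in $\mathbb{R}^d$ is called absolutely continuous if it is absolutely continuous with respect to Lebesgue measure and $\mu(A)\neq 0$ for every open set $A$; it is finite if $\mu(\mathbb{R}^d)<\infty$. Fix an orthonormal basis $(u_1,\ldots,u_d)$ of $\mathbb{R}^d$; a hyperplane is horizontal if it is orthogonal to $u_d$, with open sides $H_+=\{x+su_d: x\in H, s>0\}$, $H_-=\{x+su_d: x\in H, s<0\}$, and $\mu_\pm$ denotes $\mu$ restricted to $H_\pm$. For $v$ with $v_d\neq 0$, $p_v$ denotes projection onto $H$ in direction $v$. $(\alpha,\beta)$-partitions ($\alpha,\beta>0$, $\alpha+\beta=1$) are defined recursively: for $d=1$ the center is the point such that the rays from it in directions $-u_1$ and $u_1$ have measure $\alpha\mu(\mathbb{R})$ and $\beta\mu(\mathbb{R})$. For $d\ge 2$, halve $\mu$ by a horizontal hyperplane $H$ and choose a projection vector $v$ such that the centers of the $(\alpha,\beta)$-partitions $P_+$ of $p_v(\mu_+)$ and $P_-$ of $p_v(\mu_-)$ in $H$ (with respect to the basis $(u_1,\ldots,u_{d-1})$) coincide; the partition is $\{p_v^{-1}(C)\cap H_+: C\in P_+\}\cup\{p_v^{-1}(C)\cap H_-: C\in P_-\}$. Such a partition exists and is unique; for $\alpha=\beta=1/2$ it is the Yao–Yao equipartition, a convex partition into $2^d$ parts of equal measure in which every hyperplane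 misses the interior of some part. The $2^d$ regions of an $(\alpha,\beta)$-partition split into pairs $(A_i,B_i)$, $i=1,\ldots,2^{d-1}$, with $C_i=A_i\cup B_i$ convex, $A_i$ containing an infinite ray in direction $-u_1$, $B_i$ containing one in direction $u_1$, $\mu(A_i)=\alpha\mu(\mathbb{R}^d)/2^{d-1}$, $\mu(B_i)=\beta\mu(\mathbb{R}^d)/2^{d-1}$; the sets $C_1,\ldots,C_{2^{d-1}}$ (the frame) do not depend on $\alpha,\beta$. Multicenter partition with $t$ centers of $\mu$: for $t=1$ it is the Yao–Yao equipartition of $\mu$. For $t>1$, take the $(1/(t+1),t/(t+1))$-partition of $\mu$ with regions $A_1,\ldots,A_{2^{d-1}},B_1,\ldots,B_{2^{d-1}}$, let $B=\bigcup_i B_i$, let $P$ be a multicenter partition of $\mu|_B$ with $t-1$ centers, and set $Q=\{A_i: i=1,\ldots,2^{d-1}\}\cup\{K\cap B_i: i=1,\ldots,2^{d-1},\ K\subset C_i,\ K\in P\}$. It is a convex equipartition of $\mu$ into $(t+1)2^{d-1}$ parts. *)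

theory Defs
  imports "HOL-Analysis.Analysis"
begin

definition orthonormal_basis :: "(nat \<Rightarrow> 'a::euclidean_space) \<Rightarrow> bool" where
  "orthonormal_basis u \<longleftrightarrow>
     (\<forall>i\<in>{1..DIM('a)}. \<forall>j\<in>{1..DIM('a)}. u i \<bullet> u j = (if i = j then 1 else 0))"

text \<open>Stronger than the library's absolute continuity: nonempty open sets must have nonzero measure.\<close>

definition abs_cont_measure :: "'a::euclidean_space measure \<Rightarrow> bool" where
  "abs_cont_measure M \<longleftrightarrow>
     sets M = sets borel \<and> absolutely_continuous lborel M \<and>
     (\<forall>A. open A \<and> A \<noteq> {} \<longrightarrow> emeasure M A \<noteq> 0)"

definition is_hyperplane :: "'a::euclidean_space set \<Rightarrow> bool" where
  "is_hyperplane G \<longleftrightarrow> (\<exists>a b. a \<noteq> 0 \<and> G = {x. a \<bullet> x = b})"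

text \<open>The restriction of \<open>M\<close> to \<open>S\<close>, as the measure \<open>X \<mapsto> M (X \<inter> S)\<close> on the whole space
  (\<open>restrict_space\<close> would change the underlying space).\<close>

definition restr :: "'a measure \<Rightarrow> 'a set \<Rightarrow> 'a measure" where
  "restr M S = density M (indicator S)"

definition upper_side :: "'a::euclidean_space \<Rightarrow> 'a set \<Rightarrow> 'a set" where
  "upper_side w H = {x + s *\<^sub>R w | x s. x \<in> H \<and> s > 0}"

definition lower_side :: "'a::euclidean_space \<Rightarrow> 'a set \<Rightarrow> 'a set" where
  "lower_side w H = {x + s *\<^sub>R w | x s. x \<in> H \<and> s < 0}"

text \<open>Projection in direction \<open>v\<close> onto the hyperplane \<open>x \<bullet> w = h\<close>: the point where the line through
  \<open>x\<close> parallel to \<open>v\<close> meets it. Meaningful for \<open>v \<bullet> w \<noteq> 0\<close>.\<close>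

definition proj_along :: "'a::euclidean_space \<Rightarrow> real \<Rightarrow> 'a \<Rightarrow> 'a \<Rightarrow> 'a" where
  "proj_along w h v x = x - ((x \<bullet> w - h) / (v \<bullet> w)) *\<^sub>R v"

text \<open>
  \<open>ab_partition \<alpha> \<beta> u k F M c R\<close>: in the \<open>k\<close>-dimensional flat \<open>F\<close>, parallel to
  \<open>u 1, \<dots>, u k\<close>, the set \<open>R\<close> is the \<open>(\<alpha>, \<beta>)\<close>-partition of \<open>M\<close> with center \<open>c\<close>.
  The recursion on the dimension takes place inside one ambient space: \<open>M\<close> is a measure on the
  ambient space concentrated on \<open>F\<close>, and the next flat is the hyperplane \<open>H\<close> of \<open>F\<close>.
  The regions are recorded as the set \<open>R\<close> of pairs \<open>(A\<^sub>i, B\<^sub>i)\<close>, where \<open>A\<^sub>i\<close> and \<open>B\<^sub>i\<close>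
  are lifted from the rays in direction \<open>- u 1\<close> and \<open>u 1\<close> of the same one-dimensional partition.
\<close>

inductive ab_partition ::
  "real \<Rightarrow> real \<Rightarrow> (nat \<Rightarrow> 'a::euclidean_space) \<Rightarrow> nat \<Rightarrow> 'a set \<Rightarrow> 'a measure \<Rightarrow> 'a \<Rightarrow>
   ('a set \<times> 'a set) set \<Rightarrow> bool"
  for \<alpha> \<beta> :: real and u :: "nat \<Rightarrow> 'a" where
  line:
  "\<lbrakk> c \<in> F;
     A = {c - s *\<^sub>R u 1 | s. s \<ge> 0};
     B = {c + s *\<^sub>R u 1 | s. s \<ge> 0};
     measure M A = \<alpha> * measure M F;
     measure M B = \<beta> * measure M F \<rbrakk>
   \<Longrightarrow> ab_partition \<alpha> \<beta> u 1 F M c {(A, B)}"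
| step:
  "\<lbrakk> k \<ge> 2;
     H = {x \<in> F. x \<bullet> u k = h};
     Hp = upper_side (u k) H;
     Hm = lower_side (u k) H;
     measure M Hp = measure M F / 2;
     measure M Hm = measure M F / 2;
     v \<in> span (u ` {1..k});
     v \<bullet> u k \<noteq> 0;
     p = proj_along (u k) h v;
     ab_partition \<alpha> \<beta> u (k - 1) H (distr (restr M Hp) borel p) c Rp;
     ab_partition \<alpha> \<beta> u (k - 1) H (distr (restr M Hm) borel p) c Rm \<rbrakk>
   \<Longrightarrow> ab_partition \<alpha> \<beta> u k F M c
         ({(p -` A \<inter> Hp, p -` B \<inter> Hp) | A B. (A, B) \<in> Rp} \<union>
          {(p -` A \<inter> Hm, p -` B \<inter> Hm) | A B. (A, B) \<in> Rm})"

definition is_ab_partition ::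
  "real \<Rightarrow> real \<Rightarrow> (nat \<Rightarrow> 'a::euclidean_space) \<Rightarrow> 'a measure \<Rightarrow> ('a set \<times> 'a set) set \<Rightarrow> bool"
where
  "is_ab_partition \<alpha> \<beta> u M R \<longleftrightarrow>
     \<alpha> > 0 \<and> \<beta> > 0 \<and> \<alpha> + \<beta> = 1 \<and> (\<exists>c. ab_partition \<alpha> \<beta> u DIM('a) UNIV M c R)"

text \<open>\<open>multicenter_partition u t M P\<close>: the set of regions \<open>P\<close> is a multicenter partition of \<open>M\<close>
  with \<open>t\<close> centers with respect to the basis \<open>u\<close>. There is none for \<open>t = 0\<close>.\<close>

inductive multicenter_partition ::
  "(nat \<Rightarrow> 'a::euclidean_space) \<Rightarrow> nat \<Rightarrow> 'a measure \<Rightarrow> 'a set set \<Rightarrow> bool"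
  for u :: "nat \<Rightarrow> 'a" where
  yao_yao:
  "is_ab_partition (1/2) (1/2) u M R \<Longrightarrow> multicenter_partition u 1 M (fst ` R \<union> snd ` R)"
| add_center:
  "\<lbrakk> t > 1;
     is_ab_partition (1 / (real t + 1)) (real t / (real t + 1)) u M R;
     B = \<Union> (snd ` R);
     multicenter_partition u (t - 1) (restr M B) P \<rbrakk>
   \<Longrightarrow> multicenter_partition u t M
         (fst ` R \<union> {K \<inter> Bi | K Ai Bi. (Ai, Bi) \<in> R \<and> K \<subseteq> Ai \<union> Bi \<and> K \<in> P})"

end

theory Submission
  imports Defs
begin

text \<open>
  The cells \<open>C\<^sub>i = A\<^sub>i \<union> B\<^sub>i\<close> of an \<open>(\<alpha>, \<beta>)\<close>-partition of \<open>\<mu>\<close> form a Yao--Yao frame, and so they do for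
  \<open>\<mu>\<close> restricted to \<open>B = \<Union> B\<^sub>i\<close>, because that measure gives the same mass to every \<open>C\<^sub>i\<close>.
  Frames are unique: two different projection vectors would shift the upper and the lower half in
  opposite directions, and a shift which is lexicographically positive (ignoring the \<open>u 1\<close>-coordinate)
  moves the center to a lexicographically larger one. Hence all steps of the multicenter construction
  share one frame, each cell of which contains \<open>t + 1\<close> regions.

  Let a hyperplane be given by \<open>a \<bullet> x = b\<close> with \<open>a \<bullet> u 1 \<ge> 0\<close>, and let \<open>c\<close> be the first center. Some \<open>A\<^sub>i\<close> lies
  in \<open>a \<bullet> x \<le> a \<bullet> c\<close> and some \<open>B\<^sub>i\<close> in \<open>a \<bullet> x \<ge> a \<bullet> c\<close>. If \<open>a \<bullet> c \<le> b\<close>, the hyperplane misses the former, and by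
  induction \<open>t - 1\<close> regions inside \<open>B\<close>; otherwise it misses the latter, which contains \<open>t\<close> regions.
\<close>

section \<open>Flats and projections\<close>

text \<open>Uniqueness of frames has to compare measures on the same flat that arise from
  projections along different vectors. The comparison becomes pointwise by writing every measure of
  the recursion as the image of one fixed ambient measure, restricted to an open set \<Omega>, under
  a continuous map. Two frames are then compared over the same \<Omega> through two maps
  \<open>f\<close> and \<open>f'\<close>, and everything is read off the displacement
  \<open>f' x - f x\<close>.

  The coordinate along \<open>u 1\<close> has to stay out of the order: the place of the center on
  the last line depends on \<alpha> and \<beta>, and adding a multiple of \<open>u 1\<close> to a
  projection vector changes no cell, so neither is determined by the frame.

  Regions are counted as members of a set of sets, so distinct ones must stay distinct after they
  are cut with \<open>B\<close>. This is why positive measure and null overlaps are carried through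
  the construction, although the conclusion speaks of interiors only.\<close>

definition flat :: "(nat \<Rightarrow> 'a::euclidean_space) \<Rightarrow> nat \<Rightarrow> 'a set \<Rightarrow> bool" where
  "flat u k F \<longleftrightarrow> (\<exists>g. F = {x. \<forall>j\<in>{k<..DIM('a)}. x \<bullet> u j = g j})"

lemma orthonormal_inner:
  fixes u :: "nat \<Rightarrow> 'a::euclidean_space"
  assumes "orthonormal_basis u" "i \<in> {1..DIM('a)}" "j \<in> {1..DIM('a)}"
  shows "u i \<bullet> u j = (if i = j then 1 else 0)"
  using assms unfolding orthonormal_basis_def by blast

lemma orthonormal_span:
  fixes u :: "nat \<Rightarrow> 'a::euclidean_space"
  assumes u: "orthonormal_basis u"
  shows "span (u ` {1..DIM('a)}) = UNIV"
proof -
  have inj: "inj_on u {1..DIM('a)}"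
  proof (rule inj_onI)
    fix i j assume ij: "i \<in> {1..DIM('a)}" "j \<in> {1..DIM('a)}" "u i = u j"
    have "u i \<bullet> u j = 1" using orthonormal_inner[OF u ij(1,1)] ij(3) by simp
    then show "i = j" using orthonormal_inner[OF u ij(1,2)] by (auto split: if_splits)
  qed
  have "pairwise orthogonal (u ` {1..DIM('a)})"
    using orthonormal_inner[OF u] by (auto simp: pairwise_def orthogonal_def)
  moreover have "0 \<notin> u ` {1..DIM('a)}"
  proof
    assume "0 \<in> u ` {1..DIM('a)}"
    then obtain i where "i \<in> {1..DIM('a)}" "u i = 0" by auto
    then show False using orthonormal_inner[OF u, of i i] by simp
  qed
  ultimately have "independent (u ` {1..DIM('a)})" by (rule pairwise_orthogonal_independent)
  moreover have "card (u ` {1..DIM('a)}) = DIM('a)" using card_image[OF inj] by simp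
  ultimately show ?thesis
    using card_ge_dim_independent[of "u ` {1..DIM('a)}" UNIV] by auto
qed

lemma orthonormal_eqI:
  fixes u :: "nat \<Rightarrow> 'a::euclidean_space"
  assumes u: "orthonormal_basis u" and eq: "\<And>j. j \<in> {1..DIM('a)} \<Longrightarrow> x \<bullet> u j = y \<bullet> u j"
  shows "x = y"
proof -
  have "x - y \<in> span (u ` {1..DIM('a)})" using orthonormal_span[OF u] by simp
  moreover have "\<And>z. z \<in> u ` {1..DIM('a)} \<Longrightarrow> orthogonal (x - y) z"
    using eq by (auto simp: orthogonal_def inner_diff_left)
  ultimately have "orthogonal (x - y) (x - y)" by (rule orthogonal_to_span)
  then show ?thesis by (simp add: orthogonal_self)
qed

lemma span_inner_zero:
  fixes u :: "nat \<Rightarrow> 'a::euclidean_space"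
  assumes u: "orthonormal_basis u" and v: "v \<in> span (u ` {1..k})" and "k \<le> DIM('a)"
    and j: "j \<in> {k<..DIM('a)}"
  shows "v \<bullet> u j = 0"
proof -
  have "\<And>z. z \<in> u ` {1..k} \<Longrightarrow> orthogonal (u j) z"
    using assms orthonormal_inner[OF u, of j] by (auto simp: orthogonal_def)
  from orthogonal_to_span[OF v this] show ?thesis
    by (simp add: orthogonal_def inner_commute)
qed

lemma flat_UNIV: "flat u DIM('a) (UNIV :: 'a::euclidean_space set)"
  by (auto simp: flat_def)

lemma flat_section:
  fixes F :: "'a::euclidean_space set"
  assumes "flat u k F" "1 \<le> k" "k \<le> DIM('a)"
  shows "flat u (k - 1) {x \<in> F. x \<bullet> u k = h}"
proof -
  obtain g where g: "F = {x. \<forall>j\<in>{k<..DIM('a)}. x \<bullet> u j = g j}"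
    using assms(1) by (auto simp: flat_def)
  have "{k - 1<..DIM('a)} = insert k {k<..DIM('a)}" using assms by auto
  then have "{x \<in> F. x \<bullet> u k = h} =
      {x. \<forall>j\<in>{k - 1<..DIM('a)}. x \<bullet> u j = (g(k := h)) j}"
    by (auto simp: g)
  then show ?thesis unfolding flat_def by blast
qed

lemma flat_memI:
  fixes F :: "'a::euclidean_space set"
  assumes "flat u k F" "x \<in> F" "\<And>j. j \<in> {k<..DIM('a)} \<Longrightarrow> y \<bullet> u j = x \<bullet> u j"
  shows "y \<in> F"
  using assms by (auto simp: flat_def)

lemma flat_inner_eq:
  fixes F :: "'a::euclidean_space set"
  assumes "flat u k F" "x \<in> F" "y \<in> F" "j \<in> {k<..DIM('a)}"
  shows "y \<bullet> u j = x \<bullet> u j"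
  using assms by (auto simp: flat_def)

lemma flat_eq_INT:
  fixes u :: "nat \<Rightarrow> 'a::euclidean_space"
  shows "{x. \<forall>j\<in>{k<..DIM('a)}. x \<bullet> u j = g j} = (\<Inter>j\<in>{k<..DIM('a)}. {x. u j \<bullet> x = g j})"
  by (auto simp: inner_commute)

lemma flat_closed: "flat u k F \<Longrightarrow> closed F"
  unfolding flat_def flat_eq_INT by (auto intro!: closed_INT closed_hyperplane)

lemma flat_convex: "flat u k F \<Longrightarrow> convex F"
  unfolding flat_def flat_eq_INT by (auto intro!: convex_INT convex_hyperplane)

lemma flat_borel: "flat u k F \<Longrightarrow> F \<in> sets borel"
  by (simp add: flat_closed borel_closed)

lemma flat_add_basis:
  fixes u :: "nat \<Rightarrow> 'a::euclidean_space"
  assumes "orthonormal_basis u" "flat u k F" "x \<in> F" "i \<in> {1..k}" "k \<le> DIM('a)"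
  shows "x + s *\<^sub>R u i \<in> F"
  using assms orthonormal_inner[OF assms(1), of i]
  by (intro flat_memI[OF assms(2,3)]) (auto simp: inner_add_left)

lemma flat_nonempty:
  fixes F :: "'a::euclidean_space set"
  assumes u: "orthonormal_basis u" and F: "flat u k F"
  shows "F \<noteq> {}"
proof -
  obtain g where g: "F = {x. \<forall>j\<in>{k<..DIM('a)}. x \<bullet> u j = g j}"
    using F by (auto simp: flat_def)
  have "(\<Sum>i\<in>{1..DIM('a)}. g i *\<^sub>R u i) \<bullet> u j = g j" if "j \<in> {k<..DIM('a)}" for j
  proof -
    have "(\<Sum>i\<in>{1..DIM('a)}. g i *\<^sub>R u i) \<bullet> u j = (\<Sum>i\<in>{1..DIM('a)}. if i = j then g i else 0)"
      unfolding inner_sum_left using that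
      by (intro sum.cong) (auto simp: orthonormal_inner[OF u])
    then show ?thesis using that by simp
  qed
  then show ?thesis unfolding g by blast
qed

lemma flat_line:
  fixes F :: "'a::euclidean_space set"
  assumes u: "orthonormal_basis u" and F: "flat u 1 F" and c: "c \<in> F"
  shows "F = {c + s *\<^sub>R u 1 | s. True}"
proof
  show "{c + s *\<^sub>R u 1 | s. True} \<subseteq> F"
    using flat_add_basis[OF u F c, of 1] DIM_positive[where 'a='a] by (auto simp: Suc_le_eq)
  show "F \<subseteq> {c + s *\<^sub>R u 1 | s. True}"
  proof
    fix x assume x: "x \<in> F"
    have "x = c + ((x - c) \<bullet> u 1) *\<^sub>R u 1"
    proof (rule orthonormal_eqI[OF u])
      fix j assume j: "j \<in> {1..DIM('a)}"
      show "x \<bullet> u j = (c + ((x - c) \<bullet> u 1) *\<^sub>R u 1) \<bullet> u j"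
      proof (cases "j = 1")
        case True
        then show ?thesis using orthonormal_inner[OF u, of 1 1] j
          by (simp add: inner_add_left inner_diff_left)
      next
        case False
        then have "x \<bullet> u j = c \<bullet> u j" using flat_inner_eq[OF F c x, of j] j by auto
        then show ?thesis using orthonormal_inner[OF u, of 1 j] j False
          by (simp add: inner_add_left)
      qed
    qed
    then show "x \<in> {c + s *\<^sub>R u 1 | s. True}" by blast
  qed
qed

lemma upper_side_flat:
  fixes F :: "'a::euclidean_space set"
  assumes u: "orthonormal_basis u" and F: "flat u k F" and k: "1 \<le> k" "k \<le> DIM('a)"
  shows "upper_side (u k) {x \<in> F. x \<bullet> u k = h} = {x \<in> F. x \<bullet> u k > h}"
proof -
  have kk: "u k \<bullet> u k = 1" using orthonormal_inner[OF u, of k k] k by simp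
  have "x \<in> upper_side (u k) {x \<in> F. x \<bullet> u k = h}" if "x \<in> F" "x \<bullet> u k > h" for x
  proof -
    have "x + (h - x \<bullet> u k) *\<^sub>R u k \<in> F" using flat_add_basis[OF u F that(1), of k] k by simp
    moreover have "(x + (h - x \<bullet> u k) *\<^sub>R u k) \<bullet> u k = h" by (simp add: inner_add_left kk)
    moreover have "x = (x + (h - x \<bullet> u k) *\<^sub>R u k) + (x \<bullet> u k - h) *\<^sub>R u k"
      by (simp add: algebra_simps)
    ultimately show ?thesis using that unfolding upper_side_def
      by (intro CollectI exI[of _ "x + (h - x \<bullet> u k) *\<^sub>R u k"] exI[of _ "x \<bullet> u k - h"]) auto
  qed
  then show ?thesis using flat_add_basis[OF u F, of _ k] k
    by (auto simp: upper_side_def inner_add_left kk)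
qed

lemma lower_side_flat:
  fixes F :: "'a::euclidean_space set"
  assumes u: "orthonormal_basis u" and F: "flat u k F" and k: "1 \<le> k" "k \<le> DIM('a)"
  shows "lower_side (u k) {x \<in> F. x \<bullet> u k = h} = {x \<in> F. x \<bullet> u k < h}"
proof -
  have kk: "u k \<bullet> u k = 1" using orthonormal_inner[OF u, of k k] k by simp
  have "x \<in> lower_side (u k) {x \<in> F. x \<bullet> u k = h}" if "x \<in> F" "x \<bullet> u k < h" for x
  proof -
    have "x + (h - x \<bullet> u k) *\<^sub>R u k \<in> F" using flat_add_basis[OF u F that(1), of k] k by simp
    moreover have "(x + (h - x \<bullet> u k) *\<^sub>R u k) \<bullet> u k = h" by (simp add: inner_add_left kk)
    moreover have "x = (x + (h - x \<bullet> u k) *\<^sub>R u k) + (x \<bullet> u k - h) *\<^sub>R u k"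
      by (simp add: algebra_simps)
    ultimately show ?thesis using that unfolding lower_side_def
      by (intro CollectI exI[of _ "x + (h - x \<bullet> u k) *\<^sub>R u k"] exI[of _ "x \<bullet> u k - h"]) auto
  qed
  then show ?thesis using flat_add_basis[OF u F, of _ k] k
    by (auto simp: lower_side_def inner_add_left kk)
qed

lemma sides_borel:
  fixes F :: "'a::euclidean_space set"
  assumes "flat u k F"
  shows "{x \<in> F. x \<bullet> w > h} \<in> sets borel" "{x \<in> F. x \<bullet> w < h} \<in> sets borel"
    "{x \<in> F. x \<bullet> w = h} \<in> sets borel"
proof -
  have "{x. x \<bullet> w > h} \<in> sets borel" "{x. x \<bullet> w < h} \<in> sets borel" "{x. x \<bullet> w = h} \<in> sets borel"
    by measurable
  moreover have "{x \<in> F. x \<bullet> w > h} = F \<inter> {x. x \<bullet> w > h}" "{x \<in> F. x \<bullet> w < h} = F \<inter> {x. x \<bullet> w < h}"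
    "{x \<in> F. x \<bullet> w = h} = F \<inter> {x. x \<bullet> w = h}" by auto
  ultimately show "{x \<in> F. x \<bullet> w > h} \<in> sets borel" "{x \<in> F. x \<bullet> w < h} \<in> sets borel"
    "{x \<in> F. x \<bullet> w = h} \<in> sets borel"
    using flat_borel[OF assms] by auto
qed

lemma sides_convex:
  fixes F :: "'a::euclidean_space set"
  assumes "flat u k F"
  shows "convex {x \<in> F. x \<bullet> w > h}" "convex {x \<in> F. x \<bullet> w < h}"
proof -
  have "{x \<in> F. x \<bullet> w > h} = F \<inter> {x. w \<bullet> x > h}" "{x \<in> F. x \<bullet> w < h} = F \<inter> {x. w \<bullet> x < h}"
    by (auto simp: inner_commute)
  then show "convex {x \<in> F. x \<bullet> w > h}" "convex {x \<in> F. x \<bullet> w < h}"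
    using flat_convex[OF assms] by (auto intro: convex_Int convex_halfspace_lt convex_halfspace_gt)
qed

section \<open>Oblique projections onto a section of a flat\<close>

lemma proj_along_continuous [continuous_intros]:
  assumes "continuous_on S f"
  shows "continuous_on S (\<lambda>x. proj_along w h v (f x))"
  unfolding proj_along_def divide_inverse by (intro continuous_intros assms)

lemma proj_along_measurable [measurable]: "proj_along w h v \<in> borel_measurable borel"
  using proj_along_continuous[OF continuous_on_id, of UNIV]
  by (intro borel_measurable_continuous_onI) simp

lemma proj_along_inner:
  "proj_along w h v x \<bullet> y = x \<bullet> y - (x \<bullet> w - h) / (v \<bullet> w) * (v \<bullet> y)"
  by (simp add: proj_along_def inner_diff_left)

lemma proj_along_add:
  assumes "y \<bullet> w = 0"
  shows "proj_along w h v (x + y) = proj_along w h v x + y"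
  using assms by (simp add: proj_along_def inner_add_left)

lemma proj_along_convex_comb:
  assumes "a + b = 1"
  shows "proj_along w h v (a *\<^sub>R x + b *\<^sub>R y) = a *\<^sub>R proj_along w h v x + b *\<^sub>R proj_along w h v y"
proof -
  have "(a *\<^sub>R x + b *\<^sub>R y) \<bullet> w - h = a * (x \<bullet> w - h) + b * (y \<bullet> w - h)"
  proof -
    have "h = (a + b) * h" using assms by simp
    then show ?thesis by (simp add: inner_add_left algebra_simps)
  qed
  then show ?thesis unfolding proj_along_def
    by (simp add: scaleR_add_left scaleR_diff_right add_divide_distrib)
qed

lemma proj_along_vimage_convex:
  assumes "convex A" "convex B"
  shows "convex (proj_along w h v -` A \<inter> B)"
proof (rule convex_Int[OF _ assms(2)])
  show "convex (proj_along w h v -` A)"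
    using assms(1) unfolding convex_def by (auto simp: proj_along_convex_comb)
qed

lemma proj_along_mem_section:
  fixes F :: "'a::euclidean_space set"
  assumes u: "orthonormal_basis u" and F: "flat u k F" and k: "1 \<le> k" "k \<le> DIM('a)"
    and v: "v \<in> span (u ` {1..k})" "v \<bullet> u k \<noteq> 0" and x: "x \<in> F"
  shows "proj_along (u k) h v x \<in> {x \<in> F. x \<bullet> u k = h}"
proof -
  have "proj_along (u k) h v x \<in> F"
    by (rule flat_memI[OF F x]) (simp add: proj_along_inner span_inner_zero[OF u v(1) k(2)])
  then show ?thesis using v by (simp add: proj_along_inner)
qed

text \<open>The coefficient of the normalised direction is the signed height over the section, so
  its sign tells the upper half from the lower one. The bounds on half-spaces rest on this.\<close>

lemma proj_along_decomp: "x = proj_along w h v x + (x \<bullet> w - h) *\<^sub>R ((1 / (v \<bullet> w)) *\<^sub>R v)"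
  by (simp add: proj_along_def)

section \<open>Restrictions and image measures\<close>

lemma sets_restr [simp]: "sets (restr M S) = sets M"
  and space_restr [simp]: "space (restr M S) = space M"
  by (simp_all add: restr_def)

lemma emeasure_restr:
  assumes "S \<in> sets M" "X \<in> sets M"
  shows "emeasure (restr M S) X = emeasure M (S \<inter> X)"
  unfolding restr_def using assms by (rule emeasure_restricted)

lemma measure_restr:
  assumes "S \<in> sets M" "X \<in> sets M"
  shows "measure (restr M S) X = measure M (S \<inter> X)"
  using emeasure_restr[OF assms] by (simp add: measure_def)

lemma finite_measure_restr:
  assumes "finite_measure M" "S \<in> sets M"
  shows "finite_measure (restr M S)"
  using assms emeasure_restr[of S M "space M"] finite_measure.emeasure_finite
  by (intro finite_measureI) auto

lemma emeasure_distr_restr: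
  fixes p :: "'a \<Rightarrow> 'b::topological_space"
  assumes "S \<in> sets M" "X \<in> sets borel" "p \<in> M \<rightarrow>\<^sub>M borel"
  shows "emeasure (distr (restr M S) borel p) X = emeasure M (p -` X \<inter> S)"
proof -
  have p: "p \<in> restr M S \<rightarrow>\<^sub>M borel" using assms(3) by (simp add: measurable_def)
  have "p -` X \<inter> space M \<in> sets M" using measurable_sets[OF assms(3,2)] .
  moreover have "S \<inter> (p -` X \<inter> space M) = p -` X \<inter> S" using sets.sets_into_space[OF assms(1)] by auto
  ultimately show ?thesis
    using assms(1) emeasure_distr[OF p assms(2)] by (simp add: emeasure_restr)
qed

lemma measure_distr_restr:
  fixes p :: "'a \<Rightarrow> 'b::topological_space"
  assumes "S \<in> sets M" "X \<in> sets borel" "p \<in> M \<rightarrow>\<^sub>M borel"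
  shows "measure (distr (restr M S) borel p) X = measure M (p -` X \<inter> S)"
  using emeasure_distr_restr[OF assms] by (simp add: measure_def)

lemma finite_measure_distr_restr:
  fixes p :: "'a \<Rightarrow> 'b::topological_space"
  assumes "finite_measure M" "S \<in> sets M" "p \<in> M \<rightarrow>\<^sub>M borel"
  shows "finite_measure (distr (restr M S) borel p)"
  by (rule finite_measure.finite_measure_distr[OF finite_measure_restr[OF assms(1,2)]])
    (use assms(3) in \<open>simp add: measurable_def\<close>)

text \<open>Collapses two levels of the recursion into one, so that the measures at every depth
  remain images of a single ambient measure.\<close>

lemma distr_restr_distr_restr:
  fixes f :: "'a::topological_space \<Rightarrow> 'b::topological_space" and p :: "'b \<Rightarrow> 'c::topological_space"
  assumes M: "sets M = sets borel" and "\<Omega> \<in> sets borel" "S \<in> sets borel"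
    and f: "f \<in> borel \<rightarrow>\<^sub>M borel" and p: "p \<in> borel \<rightarrow>\<^sub>M borel"
  shows "distr (restr (distr (restr M \<Omega>) borel f) S) borel p
    = distr (restr M (\<Omega> \<inter> f -` S)) borel (\<lambda>x. p (f x))"
proof (rule measure_eqI)
  fix X assume "X \<in> sets (distr (restr (distr (restr M \<Omega>) borel f) S) borel p)"
  then have X: "X \<in> sets borel" by simp
  have fM: "f \<in> M \<rightarrow>\<^sub>M borel" using f measurable_cong_sets[OF M refl] by blast
  have pfM: "(\<lambda>x. p (f x)) \<in> M \<rightarrow>\<^sub>M borel" using measurable_compose[OF fM p] .
  have fS: "f -` S \<in> sets borel" using measurable_sets[OF f assms(3)] by simp
  have pX: "p -` X \<in> sets borel" using measurable_sets[OF p X] by simp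
  have "emeasure (distr (restr (distr (restr M \<Omega>) borel f) S) borel p) X
      = emeasure (distr (restr M \<Omega>) borel f) (p -` X \<inter> S)"
    by (rule emeasure_distr_restr) (use X p assms in \<open>auto simp: measurable_def\<close>)
  also have "\<dots> = emeasure M (f -` (p -` X \<inter> S) \<inter> \<Omega>)"
    by (rule emeasure_distr_restr) (use pX assms fM in auto)
  also have "f -` (p -` X \<inter> S) \<inter> \<Omega> = (\<lambda>x. p (f x)) -` X \<inter> (\<Omega> \<inter> f -` S)" by auto
  also have "emeasure M \<dots> = emeasure (distr (restr M (\<Omega> \<inter> f -` S)) borel (\<lambda>x. p (f x))) X"
    by (rule emeasure_distr_restr[symmetric]) (use X fS pfM assms in auto)
  finally show "emeasure (distr (restr (distr (restr M \<Omega>) borel f) S) borel p) X = \<dots>" .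
qed simp

section \<open>Regions of an \<open>(\<alpha>, \<beta>)\<close>-partition\<close>

text \<open>The comprehension in the step of \<open>ab_partition\<close> as an image, so that
  finiteness, unions and bounded quantifiers pass through a lifting.\<close>

definition lift_pairs :: "('a \<Rightarrow> 'a) \<Rightarrow> 'a set \<Rightarrow> ('a set \<times> 'a set) set \<Rightarrow> ('a set \<times> 'a set) set" where
  "lift_pairs p S R = (\<lambda>(A, B). (p -` A \<inter> S, p -` B \<inter> S)) ` R"

lemma lift_pairs_iff:
  "(A', B') \<in> lift_pairs p S R \<longleftrightarrow> (\<exists>A B. (A, B) \<in> R \<and> A' = p -` A \<inter> S \<and> B' = p -` B \<inter> S)"
  by (auto simp: lift_pairs_def)

lemma lift_pairs_ball:
  "(\<forall>(A, B)\<in>lift_pairs p S R. P A B) \<longleftrightarrow> (\<forall>(A, B)\<in>R. P (p -` A \<inter> S) (p -` B \<inter> S))"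
  by (auto simp: lift_pairs_def)

lemma lift_pairs_ballI:
  assumes "\<forall>(A, B)\<in>R. P A B" "\<And>A B. P A B \<Longrightarrow> Q (p -` A \<inter> S) (p -` B \<inter> S)"
  shows "\<forall>(A, B)\<in>lift_pairs p S R. Q A B"
  using assms by (auto simp: lift_pairs_def)

lemma lift_pairs_Union:
  "(\<Union>(A, B)\<in>lift_pairs p S R. A \<union> B) = p -` (\<Union>(A, B)\<in>R. A \<union> B) \<inter> S"
  by (force simp: lift_pairs_def)

text \<open>Carries flatness and the bound on \<open>k\<close> through the recursion, turns the two
  sides into strict inequalities on the coordinate along \<open>u k\<close>, and records that
  \<open>p\<close> maps \<open>F\<close> into \<open>H\<close>. The raw induction rule would require
  all of this to be re-derived in every use.\<close>

lemma ab_partition_induct [consumes 4, case_names line step]: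
  fixes u :: "nat \<Rightarrow> 'a::euclidean_space"
  assumes R: "ab_partition \<alpha> \<beta> u k F M c R"
    and u: "orthonormal_basis u" and F: "flat u k F" and k: "k \<le> DIM('a)"
    and line: "\<And>F M c A B. flat u 1 F \<Longrightarrow> c \<in> F \<Longrightarrow>
       A = {c - s *\<^sub>R u 1 | s. s \<ge> 0} \<Longrightarrow> B = {c + s *\<^sub>R u 1 | s. s \<ge> 0} \<Longrightarrow>
       measure M A = \<alpha> * measure M F \<Longrightarrow> measure M B = \<beta> * measure M F \<Longrightarrow> Q 1 F M c {(A, B)}"
    and step: "\<And>k F M c h v p H Hp Hm Rp Rm.
       2 \<le> k \<Longrightarrow> k \<le> DIM('a) \<Longrightarrow> flat u k F \<Longrightarrow> flat u (k - 1) H \<Longrightarrow> H = {x \<in> F. x \<bullet> u k = h} \<Longrightarrow>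
       Hp = {x \<in> F. x \<bullet> u k > h} \<Longrightarrow> Hm = {x \<in> F. x \<bullet> u k < h} \<Longrightarrow>
       measure M Hp = measure M F / 2 \<Longrightarrow> measure M Hm = measure M F / 2 \<Longrightarrow>
       v \<in> span (u ` {1..k}) \<Longrightarrow> v \<bullet> u k \<noteq> 0 \<Longrightarrow> p = proj_along (u k) h v \<Longrightarrow>
       (\<And>x. x \<in> F \<Longrightarrow> p x \<in> H) \<Longrightarrow>
       ab_partition \<alpha> \<beta> u (k - 1) H (distr (restr M Hp) borel p) c Rp \<Longrightarrow>
       ab_partition \<alpha> \<beta> u (k - 1) H (distr (restr M Hm) borel p) c Rm \<Longrightarrow>
       Q (k - 1) H (distr (restr M Hp) borel p) c Rp \<Longrightarrow>
       Q (k - 1) H (distr (restr M Hm) borel p) c Rm \<Longrightarrow>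
       Q k F M c (lift_pairs p Hp Rp \<union> lift_pairs p Hm Rm)"
  shows "Q k F M c R"
  using R F k
proof (induction rule: ab_partition.induct)
  case (line c F A B M)
  then show ?case by (intro assms(5)) auto
next
  case (step k H F h Hp Hm M v p c Rp Rm)
  have fl: "flat u (k - 1) H" unfolding step.hyps(2) using step by (intro flat_section) auto
  have "Q k F M c (lift_pairs p Hp Rp \<union> lift_pairs p Hm Rm)"
  proof (rule assms(6)[where H = H and h = h])
    show "Hp = {x \<in> F. x \<bullet> u k > h}" "Hm = {x \<in> F. x \<bullet> u k < h}"
      using step upper_side_flat[OF u step.prems(1)] lower_side_flat[OF u step.prems(1)] by auto
    show "p x \<in> H" if "x \<in> F" for x
      using proj_along_mem_section[OF u step.prems(1) _ _ _ _ that] step by auto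
  qed (use step fl in auto)
  moreover have "lift_pairs p Hp Rp \<union> lift_pairs p Hm Rm =
      {(p -` A \<inter> Hp, p -` B \<inter> Hp) | A B. (A, B) \<in> Rp} \<union>
      {(p -` A \<inter> Hm, p -` B \<inter> Hm) | A B. (A, B) \<in> Rm}"
    by (auto simp: lift_pairs_def)
  ultimately show ?case by simp
qed

lemma ab_partition_finite:
  fixes u :: "nat \<Rightarrow> 'a::euclidean_space"
  assumes "ab_partition \<alpha> \<beta> u k F M c R" "orthonormal_basis u" "flat u k F" "k \<le> DIM('a)"
  shows "finite R"
  using assms by (induction rule: ab_partition_induct) (auto simp: lift_pairs_def)

lemma ray_convex_closed:
  fixes c w :: "'a::euclidean_space"
  shows "convex {c + s *\<^sub>R w | s. s \<ge> 0}" "closed {c + s *\<^sub>R w | s. s \<ge> 0}"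
proof -
  have eq: "{c + s *\<^sub>R w | s. s \<ge> 0} = (\<lambda>x. c + x) ` ((\<lambda>s. s *\<^sub>R w) ` {0..})"
    by (auto simp: image_iff)
  have "convex ((\<lambda>s. s *\<^sub>R w) ` {0::real..})"
    by (intro convex_linear_image) (auto intro!: linearI simp: algebra_simps)
  then show "convex {c + s *\<^sub>R w | s. s \<ge> 0}" unfolding eq by (simp only: convex_translation)
  have "closed ((\<lambda>s. s *\<^sub>R w) ` {0::real..})"
  proof (cases "w = 0")
    case True
    then have "(\<lambda>s. s *\<^sub>R w) ` {0::real..} = {0}" by auto
    then show ?thesis by simp
  next
    case False
    then show ?thesis
      by (intro closed_injective_linear_image) (auto intro!: linearI injI simp: algebra_simps)
  qed
  then show "closed {c + s *\<^sub>R w | s. s \<ge> 0}" unfolding eq by (rule closed_translation)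
qed

lemma opposite_rays:
  fixes u :: "nat \<Rightarrow> 'a::euclidean_space"
  assumes u: "orthonormal_basis u" "flat u 1 F" "c \<in> F"
    and A: "A = {c - s *\<^sub>R u 1 | s. s \<ge> 0}" and B: "B = {c + s *\<^sub>R u 1 | s. s \<ge> 0}"
  shows "convex A" "convex B" "A \<in> sets borel" "B \<in> sets borel" "A \<union> B = F"
    "\<forall>x\<in>B. \<forall>s\<ge>0. x + s *\<^sub>R u 1 \<in> B" "\<forall>x\<in>A. \<exists>s\<ge>0. x + s *\<^sub>R u 1 \<in> B"
proof -
  have A': "A = {c + s *\<^sub>R (- u 1) | s. s \<ge> 0}" using A by simp
  show "convex A" "A \<in> sets borel" unfolding A' by (intro borel_closed ray_convex_closed)+
  show "convex B" "B \<in> sets borel" unfolding B by (intro borel_closed ray_convex_closed)+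
  have "c + s *\<^sub>R u 1 \<in> A \<union> B" for s
  proof (cases "s \<ge> 0")
    case False
    then have "c + s *\<^sub>R u 1 = c - (- s) *\<^sub>R u 1" "- s \<ge> 0" by auto
    then show ?thesis unfolding A by blast
  qed (auto simp: B)
  moreover have "c - s *\<^sub>R u 1 = c + (- s) *\<^sub>R u 1" for s by simp
  ultimately show "A \<union> B = F" unfolding flat_line[OF u] A B by blast
  have "c + r *\<^sub>R u 1 + s *\<^sub>R u 1 \<in> B" if "r \<ge> 0" "s \<ge> 0" for r s
    using that by (auto simp: B intro!: exI[of _ "r + s"] simp: algebra_simps)
  then show "\<forall>x\<in>B. \<forall>s\<ge>0. x + s *\<^sub>R u 1 \<in> B" by (auto simp: B)
  have "c - r *\<^sub>R u 1 + r *\<^sub>R u 1 \<in> B" for r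
    by (auto simp: B intro!: exI[of _ "0::real"])
  then show "\<forall>x\<in>A. \<exists>s\<ge>0. x + s *\<^sub>R u 1 \<in> B" unfolding A by blast
qed

lemma ab_partition_convex_borel:
  fixes u :: "nat \<Rightarrow> 'a::euclidean_space"
  assumes "ab_partition \<alpha> \<beta> u k F M c R" "orthonormal_basis u" "flat u k F" "k \<le> DIM('a)"
  shows "\<forall>(A, B)\<in>R. convex A \<and> convex B \<and> A \<in> sets borel \<and> B \<in> sets borel \<and> A \<union> B \<subseteq> F"
  using assms
proof (induction rule: ab_partition_induct)
  case (line F M c A B)
  then show ?case using opposite_rays[OF assms(2) line(1-4)] by auto
next
  case (step k F M c h v p H Hp Hm Rp Rm)
  have "convex (p -` A \<inter> S) \<and> p -` A \<inter> S \<in> sets borel \<and> p -` A \<inter> S \<subseteq> F"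
    if "convex A" "A \<in> sets borel" "S = Hp \<or> S = Hm" for A S
  proof -
    have "convex S" "S \<in> sets borel" "S \<subseteq> F"
      using that sides_convex[OF step(3)] sides_borel[OF step(3)] step by auto
    moreover have "p -` A \<in> sets borel"
      using measurable_sets[OF proj_along_measurable that(2), of "u k" h v] step by simp
    ultimately show ?thesis
      unfolding step(12) using that(1) by (intro conjI proj_along_vimage_convex sets.Int) auto
  qed
  then show ?case using step.IH unfolding ball_Un lift_pairs_ball by (simp add: split_beta)
qed

text \<open>True for two opposite rays, and preserved by lifting because \<open>p\<close> commutes
  with translations along \<open>u 1\<close> and both sides are invariant under them. It serves to
  move a point of any cell into its \<open>B\<close> along \<open>u 1\<close>.\<close>

lemma ab_partition_ray:
  fixes u :: "nat \<Rightarrow> 'a::euclidean_space"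
  assumes "ab_partition \<alpha> \<beta> u k F M c R" and u: "orthonormal_basis u"
    and "flat u k F" "k \<le> DIM('a)"
  shows "\<forall>(A, B)\<in>R. (\<forall>x\<in>B. \<forall>s\<ge>0. x + s *\<^sub>R u 1 \<in> B) \<and> (\<forall>x\<in>A. \<exists>s\<ge>0. x + s *\<^sub>R u 1 \<in> B)"
  using assms
proof (induction rule: ab_partition_induct)
  case (line F M c A B)
  then show ?case using opposite_rays(6,7)[OF u line(1-4)] by auto
next
  case (step k F M c h v p H Hp Hm Rp Rm)
  have 1: "u 1 \<bullet> u k = 0" using orthonormal_inner[OF u, of 1 k] step by auto
  have p: "p (x + s *\<^sub>R u 1) = p x + s *\<^sub>R u 1" for x s
    using 1 step by (simp add: proj_along_add)
  have S: "x + s *\<^sub>R u 1 \<in> S" if "S = Hp \<or> S = Hm" "x \<in> S" for x s S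
    using that flat_add_basis[OF u step(3), of x 1] step 1 by (auto simp: inner_add_left)
  have lift: "(\<forall>x\<in>p -` B \<inter> S. \<forall>s\<ge>0. x + s *\<^sub>R u 1 \<in> p -` B \<inter> S) \<and>
      (\<forall>x\<in>p -` A \<inter> S. \<exists>s\<ge>0. x + s *\<^sub>R u 1 \<in> p -` B \<inter> S)"
    if "(\<forall>x\<in>B. \<forall>s\<ge>0. x + s *\<^sub>R u 1 \<in> B) \<and> (\<forall>x\<in>A. \<exists>s\<ge>0. x + s *\<^sub>R u 1 \<in> B)" "S = Hp \<or> S = Hm"
    for A B S
  proof (intro conjI ballI)
    fix x assume "x \<in> p -` B \<inter> S"
    then show "\<forall>s\<ge>0. x + s *\<^sub>R u 1 \<in> p -` B \<inter> S" using that S[OF that(2)] p by auto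
  next
    fix x assume x: "x \<in> p -` A \<inter> S"
    then have "p x \<in> A" by simp
    from bspec[OF conjunct2[OF that(1)] this] obtain s where "s \<ge> 0" "p x + s *\<^sub>R u 1 \<in> B"
      by blast
    then show "\<exists>s\<ge>0. x + s *\<^sub>R u 1 \<in> p -` B \<inter> S" using x S[OF that(2), of x s] p by auto
  qed
  show ?case unfolding ball_Un
  proof (rule conjI, goal_cases)
    case 1
    show ?case by (rule lift_pairs_ballI[OF step.IH(1)], rule lift, assumption, simp)
  next
    case 2
    show ?case by (rule lift_pairs_ballI[OF step.IH(2)], rule lift, assumption, simp)
  qed
qed

text \<open>Only whole cells are disjoint: both rays on the line contain the center, so
  \<open>A\<close> and \<open>B\<close> of one pair may meet in what is lifted from it. Cells from
  different halves are separated because they lie in opposite open sides.\<close>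

lemma ab_partition_disjoint:
  fixes u :: "nat \<Rightarrow> 'a::euclidean_space"
  assumes "ab_partition \<alpha> \<beta> u k F M c R" and u: "orthonormal_basis u"
    and "flat u k F" "k \<le> DIM('a)"
  shows "\<forall>(A, B)\<in>R. \<forall>(A', B')\<in>R. A = A' \<and> B = B' \<or> (A \<union> B) \<inter> (A' \<union> B') = {}"
  using assms
proof (induction rule: ab_partition_induct)
  case (line F M c A B)
  then show ?case by auto
next
  case (step k F M c h v p H Hp Hm Rp Rm)
  have "Hp \<inter> Hm = {}" using step by auto
  then have "(p -` A \<inter> Hp \<union> p -` B \<inter> Hp) \<inter> (p -` A' \<inter> Hm \<union> p -` B' \<inter> Hm) = {}"
    "(p -` A \<inter> Hm \<union> p -` B \<inter> Hm) \<inter> (p -` A' \<inter> Hp \<union> p -` B' \<inter> Hp) = {}" for A B A' B'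
    by blast+
  moreover have "p -` A \<inter> S = p -` A' \<inter> S \<and> p -` B \<inter> S = p -` B' \<inter> S \<or>
      (p -` A \<inter> S \<union> p -` B \<inter> S) \<inter> (p -` A' \<inter> S \<union> p -` B' \<inter> S) = {}"
    if "A = A' \<and> B = B' \<or> (A \<union> B) \<inter> (A' \<union> B') = {}" for A B A' B' S
    using that by auto
  ultimately show ?case using step.IH unfolding ball_Un lift_pairs_ball
    by (simp add: split_beta)
qed

text \<open>The null sets come from the balance of mass: \<alpha> + \<beta> = 1 leaves nothing for
  the common point of the two rays, and two open sides with half of the mass each leave nothing for
  \<open>H\<close>.\<close>

lemma ab_partition_measure:
  fixes u :: "nat \<Rightarrow> 'a::euclidean_space"
  assumes "ab_partition \<alpha> \<beta> u k F M c R" and u: "orthonormal_basis u"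
    and "flat u k F" "k \<le> DIM('a)"
    and "finite_measure M" "sets M = sets borel" "\<alpha> + \<beta> = 1"
  shows "(\<forall>(A, B)\<in>R. A \<in> sets borel \<and> B \<in> sets borel \<and>
            measure M A = \<alpha> * measure M F / 2 ^ (k - 1) \<and>
            measure M B = \<beta> * measure M F / 2 ^ (k - 1) \<and> measure M (A \<inter> B) = 0) \<and>
         finite R \<and> measure M (F - (\<Union>(A, B)\<in>R. A \<union> B)) = 0"
  using assms(1-6)
proof (induction rule: ab_partition_induct)
  case (line F M c A B)
  interpret finite_measure M by fact
  note rays = opposite_rays[OF u line(1-4)]
  have "measure M (A \<union> B) = measure M A + measure M B - measure M (A \<inter> B)"
    using rays line measure_Un3[of A M B] by (simp add: fmeasurable_eq_sets)
  also have "measure M A + measure M B = measure M F"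
    using line \<open>\<alpha> + \<beta> = 1\<close> by (simp add: distrib_right[symmetric])
  finally show ?case using line rays by auto
next
  case (step k F M c h v p H Hp Hm Rp Rm)
  interpret finite_measure M by fact
  have pm: "p \<in> M \<rightarrow>\<^sub>M borel" using step by (simp cong: measurable_cong_sets)
  have S: "F \<in> sets M" "H \<in> sets M" "Hp \<in> sets M" "Hm \<in> sets M"
    using flat_borel[OF step(3)] sides_borel[OF step(3)] step by auto
  define N where "N S = distr (restr M S) borel p" for S
  have side: "(\<forall>(A, B)\<in>lift_pairs p S R. A \<in> sets borel \<and> B \<in> sets borel \<and>
        measure M A = \<alpha> * measure M F / 2 ^ (k - 1) \<and>
        measure M B = \<beta> * measure M F / 2 ^ (k - 1) \<and> measure M (A \<inter> B) = 0) \<and>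
      finite (lift_pairs p S R) \<and> S - (\<Union>(A, B)\<in>lift_pairs p S R. A \<union> B) \<in> sets borel \<and>
      measure M (S - (\<Union>(A, B)\<in>lift_pairs p S R. A \<union> B)) = 0"
    if S': "S = Hp \<or> S = Hm" and IH: "finite_measure (N S) \<Longrightarrow> sets (N S) = sets borel \<Longrightarrow>
      (\<forall>(A, B)\<in>R. A \<in> sets borel \<and> B \<in> sets borel \<and>
        measure (N S) A = \<alpha> * measure (N S) H / 2 ^ (k - 1 - 1) \<and>
        measure (N S) B = \<beta> * measure (N S) H / 2 ^ (k - 1 - 1) \<and> measure (N S) (A \<inter> B) = 0) \<and>
      finite R \<and> measure (N S) (H - (\<Union>(A, B)\<in>R. A \<union> B)) = 0" for S R
  proof -
    have Sm: "S \<in> sets M" and SH: "p -` H \<inter> S = S" using S S' step by auto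
    have N: "measure (N S) X = measure M (p -` X \<inter> S)" if "X \<in> sets borel" for X
      unfolding N_def using measure_distr_restr[OF Sm that pm] .
    have NH: "measure (N S) H = measure M F / 2" using N[of H] S S' SH step by auto
    \<comment> \<open>The halved mass supplies one factor 2; \<open>k - 1 - 1\<close> is a true
      predecessor because \<open>k\<close> is at least 2.\<close>
    have pow: "x * (measure M F / 2) / 2 ^ (k - 1 - 1) = x * measure M F / 2 ^ (k - 1)" for x
      using \<open>2 \<le> k\<close> by (cases "k - 1") auto
    have pX: "p -` X \<inter> S \<in> sets borel" if "X \<in> sets borel" for X
      using measurable_sets[OF pm, of X] that Sm step sets_eq_imp_space_eq[of M borel] by auto
    have "finite_measure (N S)"
      unfolding N_def using finite_measure_distr_restr[OF \<open>finite_measure M\<close> Sm pm] .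
    then have IH': "\<forall>(A, B)\<in>R. A \<in> sets borel \<and> B \<in> sets borel \<and>
        measure (N S) A = \<alpha> * measure M F / 2 ^ (k - 1) \<and>
        measure (N S) B = \<beta> * measure M F / 2 ^ (k - 1) \<and> measure (N S) (A \<inter> B) = 0"
      "finite R" "measure (N S) (H - (\<Union>(A, B)\<in>R. A \<union> B)) = 0"
      using IH unfolding NH pow by (auto simp: N_def)
    have "H - (\<Union>(A, B)\<in>R. A \<union> B) \<in> sets borel"
      using IH'(1,2) S step by (intro sets.Diff sets.finite_UN) auto
    moreover have "p -` (H - (\<Union>(A, B)\<in>R. A \<union> B)) \<inter> S = S - (\<Union>(A, B)\<in>lift_pairs p S R. A \<union> B)"
      using SH unfolding lift_pairs_Union by auto
    ultimately have "S - (\<Union>(A, B)\<in>lift_pairs p S R. A \<union> B) \<in> sets borel"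
      "measure M (S - (\<Union>(A, B)\<in>lift_pairs p S R. A \<union> B)) = 0"
      using IH'(3) N pX by metis+
    moreover have "\<forall>(A, B)\<in>lift_pairs p S R. A \<in> sets borel \<and> B \<in> sets borel \<and>
        measure M A = \<alpha> * measure M F / 2 ^ (k - 1) \<and>
        measure M B = \<beta> * measure M F / 2 ^ (k - 1) \<and> measure M (A \<inter> B) = 0"
      unfolding lift_pairs_ball
    proof (intro ballI, unfold split_paired_all prod.case)
      fix A B assume "(A, B) \<in> R"
      then have AB: "A \<in> sets borel" "B \<in> sets borel"
        "measure (N S) A = \<alpha> * measure M F / 2 ^ (k - 1)"
        "measure (N S) B = \<beta> * measure M F / 2 ^ (k - 1)" "measure (N S) (A \<inter> B) = 0"
        using IH'(1) by auto
      have "p -` A \<inter> S \<inter> (p -` B \<inter> S) = p -` (A \<inter> B) \<inter> S" by auto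
      then show "p -` A \<inter> S \<in> sets borel \<and> p -` B \<inter> S \<in> sets borel \<and>
          measure M (p -` A \<inter> S) = \<alpha> * measure M F / 2 ^ (k - 1) \<and>
          measure M (p -` B \<inter> S) = \<beta> * measure M F / 2 ^ (k - 1) \<and>
          measure M (p -` A \<inter> S \<inter> (p -` B \<inter> S)) = 0"
        using AB pX[OF AB(1)] pX[OF AB(2)] N[OF AB(1)] N[OF AB(2)] N[OF sets.Int[OF AB(1,2)]]
        by metis
    qed
    ultimately show ?thesis using IH'(2) by (simp add: lift_pairs_def)
  qed
  note sp = side[OF disjI1[OF refl] step.IH(1)[folded N_def]]
    and sm = side[OF disjI2[OF refl] step.IH(2)[folded N_def]]
  note sp1 = sp[THEN conjunct1] and sp2 = sp[THEN conjunct2, THEN conjunct1]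
    and sp3 = sp[THEN conjunct2, THEN conjunct2, THEN conjunct1]
    and sp4 = sp[THEN conjunct2, THEN conjunct2, THEN conjunct2]
  note sm1 = sm[THEN conjunct1] and sm2 = sm[THEN conjunct2, THEN conjunct1]
    and sm3 = sm[THEN conjunct2, THEN conjunct2, THEN conjunct1]
    and sm4 = sm[THEN conjunct2, THEN conjunct2, THEN conjunct2]
  have "measure M F = measure M (Hp \<union> Hm) + measure M H"
  proof -
    have "F = (Hp \<union> Hm) \<union> H" "(Hp \<union> Hm) \<inter> H = {}" using step by auto
    then show ?thesis using finite_measure_Union[of "Hp \<union> Hm" H] S by simp
  qed
  also have "measure M (Hp \<union> Hm) = measure M Hp + measure M Hm"
    using S step by (intro finite_measure_Union) auto
  finally have H0: "measure M H = 0" using step by simp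
  let ?D = "\<lambda>S R. S - (\<Union>(A, B)\<in>lift_pairs p S R. A \<union> B)"
  have Dm: "?D Hp Rp \<in> sets M" "?D Hm Rm \<in> sets M"
    using sp3 sm3 unfolding step.prems(2) by blast+
  have "F - (\<Union>(A, B)\<in>lift_pairs p Hp Rp \<union> lift_pairs p Hm Rm. A \<union> B) \<subseteq> H \<union> (?D Hp Rp \<union> ?D Hm Rm)"
  proof -
    have "F \<subseteq> H \<union> Hp \<union> Hm" using step(5-7) by auto
    then show ?thesis unfolding UN_Un by blast
  qed
  then have "measure M (F - (\<Union>(A, B)\<in>lift_pairs p Hp Rp \<union> lift_pairs p Hm Rm. A \<union> B))
      \<le> measure M (H \<union> (?D Hp Rp \<union> ?D Hm Rm))"
    using S Dm by (intro finite_measure_mono) auto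
  also have "\<dots> \<le> measure M H + (measure M (?D Hp Rp) + measure M (?D Hm Rm))"
    using S Dm by (intro order_trans[OF measure_Un_le] add_left_mono measure_Un_le) auto
  also have "\<dots> = 0" using H0 sp4 sm4 by simp
  finally have "measure M (F - (\<Union>(A, B)\<in>lift_pairs p Hp Rp \<union> lift_pairs p Hm Rm. A \<union> B)) = 0"
    by (simp add: measure_le_0_iff)
  then show ?case using sp1 sm1 sp2 sm2 unfolding ball_Un finite_Un by blast
qed

text \<open>Passing from \<open>p x\<close> to \<open>x\<close> changes the functional by the height
  of \<open>x\<close> times a fixed slope \<open>n\<close>. Whatever the sign of \<open>n\<close>,
  the upper bound survives on one side of \<open>H\<close> and the lower bound on the opposite side.
  Both halves have the same center, so the two bounds may be taken from different halves.\<close>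

lemma ab_partition_halfspaces:
  fixes u :: "nat \<Rightarrow> 'a::euclidean_space"
  assumes "ab_partition \<alpha> \<beta> u k F M c R" and u: "orthonormal_basis u"
    and "flat u k F" "k \<le> DIM('a)" and a: "0 \<le> a \<bullet> u 1"
  shows "(\<exists>(A, B)\<in>R. \<forall>x\<in>A. a \<bullet> x \<le> a \<bullet> c) \<and> (\<exists>(A, B)\<in>R. \<forall>x\<in>B. a \<bullet> c \<le> a \<bullet> x)"
  using assms(1-4)
proof (induction rule: ab_partition_induct)
  case (line F M c A B)
  then show ?case using a by (auto simp: inner_add_right inner_diff_right)
next
  case (step k F M c h v p H Hp Hm Rp Rm)
  define n where "n = a \<bullet> ((1 / (v \<bullet> u k)) *\<^sub>R v)"
  have x: "a \<bullet> x = a \<bullet> p x + (x \<bullet> u k - h) * n" for x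
    by (subst proj_along_decomp[of x "u k" h v]) (simp add: inner_add_right n_def step(12))
  obtain Ap Bp Ap' Bp' where p: "(Ap, Bp) \<in> Rp" "\<forall>x\<in>Ap. a \<bullet> x \<le> a \<bullet> c"
    "(Ap', Bp') \<in> Rp" "\<forall>x\<in>Bp'. a \<bullet> c \<le> a \<bullet> x" using step.IH(1) by auto
  obtain Am Bm Am' Bm' where m: "(Am, Bm) \<in> Rm" "\<forall>x\<in>Am. a \<bullet> x \<le> a \<bullet> c"
    "(Am', Bm') \<in> Rm" "\<forall>x\<in>Bm'. a \<bullet> c \<le> a \<bullet> x" using step.IH(2) by auto
  have Hp: "x \<bullet> u k - h > 0" if "x \<in> Hp" for x using that step(6) by auto
  have Hm: "x \<bullet> u k - h < 0" if "x \<in> Hm" for x using that step(7) by auto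
  have mem: "(p -` A \<inter> Hp, p -` B \<inter> Hp) \<in> lift_pairs p Hp Rp" if "(A, B) \<in> Rp" for A B
    using that by (auto simp: lift_pairs_iff)
  have mem': "(p -` A \<inter> Hm, p -` B \<inter> Hm) \<in> lift_pairs p Hm Rm" if "(A, B) \<in> Rm" for A B
    using that by (auto simp: lift_pairs_iff)
  show ?case
  proof (cases "n \<le> 0")
    case True
    have "\<forall>x\<in>p -` Ap \<inter> Hp. a \<bullet> x \<le> a \<bullet> c"
    proof
      fix x assume "x \<in> p -` Ap \<inter> Hp"
      then have "a \<bullet> p x \<le> a \<bullet> c" "(x \<bullet> u k - h) * n \<le> 0"
        using p Hp[of x] True by (auto intro: mult_nonneg_nonpos)
      then show "a \<bullet> x \<le> a \<bullet> c" using x[of x] by simp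
    qed
    moreover have "\<forall>x\<in>p -` Bm' \<inter> Hm. a \<bullet> c \<le> a \<bullet> x"
    proof
      fix x assume "x \<in> p -` Bm' \<inter> Hm"
      then have "a \<bullet> c \<le> a \<bullet> p x" "(x \<bullet> u k - h) * n \<ge> 0"
        using m Hm[of x] True by (auto intro: mult_nonpos_nonpos)
      then show "a \<bullet> c \<le> a \<bullet> x" using x[of x] by simp
    qed
    ultimately show ?thesis using mem[OF p(1)] mem'[OF m(3)] by (simp add: bex_Un) blast
  next
    case False
    have "\<forall>x\<in>p -` Am \<inter> Hm. a \<bullet> x \<le> a \<bullet> c"
    proof
      fix x assume "x \<in> p -` Am \<inter> Hm"
      then have "a \<bullet> p x \<le> a \<bullet> c" "(x \<bullet> u k - h) * n \<le> 0"
        using m Hm[of x] False by (auto intro: mult_nonpos_nonneg)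
      then show "a \<bullet> x \<le> a \<bullet> c" using x[of x] by simp
    qed
    moreover have "\<forall>x\<in>p -` Bp' \<inter> Hp. a \<bullet> c \<le> a \<bullet> x"
    proof
      fix x assume "x \<in> p -` Bp' \<inter> Hp"
      then have "a \<bullet> c \<le> a \<bullet> p x" "(x \<bullet> u k - h) * n \<ge> 0"
        using p Hp[of x] False by auto
      then show "a \<bullet> c \<le> a \<bullet> x" using x[of x] by simp
    qed
    ultimately show ?thesis using mem[OF p(3)] mem'[OF m(1)] by (simp add: bex_Un) blast
  qed
qed

section \<open>Frames and their uniqueness\<close>

text \<open>The recursion behind \<open>ab_partition\<close> with the split along \<open>u 1\<close> forgotten. All cells are unions of
  lines parallel to \<open>u 1\<close>, so only the coordinates \<open>2, \<dots>, k\<close> of the center matter.\<close>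

inductive yao_frame ::
  "(nat \<Rightarrow> 'a::euclidean_space) \<Rightarrow> nat \<Rightarrow> 'a set \<Rightarrow> 'a measure \<Rightarrow> 'a \<Rightarrow> 'a set set \<Rightarrow> bool"
  for u :: "nat \<Rightarrow> 'a" where
  line: "c \<in> F \<Longrightarrow> yao_frame u 1 F M c {F}"
| step: "\<lbrakk> k \<ge> 2; H = {x \<in> F. x \<bullet> u k = h}; Hp = {x \<in> F. x \<bullet> u k > h}; Hm = {x \<in> F. x \<bullet> u k < h};
     measure M Hp = measure M F / 2; measure M Hm = measure M F / 2;
     v \<in> span (u ` {1..k}); v \<bullet> u k \<noteq> 0; p = proj_along (u k) h v;
     yao_frame u (k - 1) H (distr (restr M Hp) borel p) c Cp;
     yao_frame u (k - 1) H (distr (restr M Hm) borel p) c Cm \<rbrakk>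
   \<Longrightarrow> yao_frame u k F M c ((\<lambda>C. p -` C \<inter> Hp) ` Cp \<union> (\<lambda>C. p -` C \<inter> Hm) ` Cm)"

lemma yao_frame_center: "yao_frame u k F M c CC \<Longrightarrow> c \<in> F"
  by (induction rule: yao_frame.induct) auto

lemma yao_frame_line: "yao_frame u 1 F M c CC \<Longrightarrow> CC = {F}"
  by (erule yao_frame.cases) auto

text \<open>Makes the preimage of a cell insensitive to a change of the projection along
  \<open>u 1\<close>, the only freedom that the comparison of two projection vectors leaves
  open.\<close>

lemma yao_frame_invariant:
  fixes u :: "nat \<Rightarrow> 'a::euclidean_space"
  assumes "yao_frame u k F M c CC" and u: "orthonormal_basis u"
    and "flat u k F" "k \<le> DIM('a)" and "C \<in> CC" "x \<in> C"
  shows "x + s *\<^sub>R u 1 \<in> C"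
  using assms(1,3-)
proof (induction arbitrary: C x rule: yao_frame.induct)
  case (line c F M)
  then show ?case using flat_add_basis[OF u, of 1 F x 1] by auto
next
  case (step k H F h Hp Hm M v p c Cp Cm)
  have 1: "u 1 \<bullet> u k = 0" using orthonormal_inner[OF u, of 1 k] step.hyps(1) step.prems(2) by auto
  have p: "p (x + s *\<^sub>R u 1) = p x + s *\<^sub>R u 1" for x
    unfolding step.hyps(9) using 1 by (simp add: proj_along_add)
  have S: "x + s *\<^sub>R u 1 \<in> S" if "S = Hp \<or> S = Hm" "x \<in> S" for x S
    using that flat_add_basis[OF u step.prems(1), of x 1] step.hyps(1-4) step.prems(2) 1
    by (auto simp: inner_add_left)
  have H: "flat u (k - 1) H" unfolding step.hyps(2) using step.hyps(1) step.prems(1,2)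
    by (intro flat_section) auto
  have k: "k - 1 \<le> DIM('a)" using step.prems(2) by simp
  from step.prems(3) consider C' where "C' \<in> Cp" "C = p -` C' \<inter> Hp" | C' where "C' \<in> Cm" "C = p -` C' \<inter> Hm"
    by blast
  then show ?case
  proof cases
    case 1
    then show ?thesis using step.IH(1)[OF H k 1(1), of "p x"] S[of Hp x] p[of x] step.prems(4) by auto
  next
    case 2
    then show ?thesis using step.IH(2)[OF H k 2(1), of "p x"] S[of Hm x] p[of x] step.prems(4) by auto
  qed
qed

text \<open>A frame sees the measure only through its halvings, so equal mass on all cells and none
  outside is all that \<open>N\<close> has to provide. The total mass belongs to the conclusion
  because the induction reads the halving off it: both sides come out with the same mass.\<close>

lemma yao_frame_of_ab_partition:
  fixes u :: "nat \<Rightarrow> 'a::euclidean_space"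
  assumes "ab_partition \<alpha> \<beta> u k F M c R" and u: "orthonormal_basis u"
    and "flat u k F" "k \<le> DIM('a)"
    and "finite_measure N" "sets N = sets borel"
    and "\<forall>(A, B)\<in>R. measure N (A \<union> B) = m"
    and "measure N (F - (\<Union>(A, B)\<in>R. A \<union> B)) = 0"
  shows "yao_frame u k F N c ((\<lambda>(A, B). A \<union> B) ` R) \<and> measure N F = 2 ^ (k - 1) * m"
  using assms
proof (induction arbitrary: N rule: ab_partition_induct)
  case (line F M c A B)
  have "A \<union> B = F" using opposite_rays(5)[OF u line(1-4)] .
  then show ?case using line.prems yao_frame.line[OF line(2), of u N] by simp
next
  case (step k F M c h v p H Hp Hm Rp Rm)
  interpret finite_measure N by fact
  let ?U = "\<lambda>R. \<Union>(A, B)\<in>R. A \<union> B"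
  let ?R = "lift_pairs p Hp Rp \<union> lift_pairs p Hm Rm"
  have k1: "k - 1 \<le> DIM('a)" using step(2) by simp
  have pm: "p \<in> N \<rightarrow>\<^sub>M borel" unfolding step(12) using step.prems(2) by (simp cong: measurable_cong_sets)
  have S: "F \<in> sets N" "H \<in> sets N" "Hp \<in> sets N" "Hm \<in> sets N"
    unfolding step(5-7) step.prems(2) using flat_borel[OF step(3)] sides_borel[OF step(3)] by auto
  have Fun: "F = (Hp \<union> Hm) \<union> H" "(Hp \<union> Hm) \<inter> H = {}" "Hp \<inter> Hm = {}"
    unfolding step(5-7) by auto
  have pX: "p -` X \<inter> S \<in> sets N" if "X \<in> sets borel" "S \<in> sets N" for X S
    using measurable_sets[OF pm that(1)] that(2) sets_eq_imp_space_eq[OF step.prems(2)] by auto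
  have Ub: "?U R' \<in> sets borel" if "ab_partition \<alpha> \<beta> u (k - 1) H N' c R'" for R' N'
    using ab_partition_convex_borel[OF that u step(4) k1] ab_partition_finite[OF that u step(4) k1]
    by (intro sets.finite_UN) auto
  have URm: "?U ?R \<in> sets N"
    unfolding UN_Un lift_pairs_Union using pX S Ub[OF step(14)] Ub[OF step(15)] by (intro sets.Un) auto
  \<comment> \<open>The cells lie in the open sides, so \<open>H\<close> is contained in the
    uncovered part, which is null.\<close>
  have H0: "measure N H = 0"
  proof -
    have "?U ?R \<inter> H = {}" unfolding UN_Un lift_pairs_Union using Fun by blast
    then have "H \<subseteq> F - ?U ?R" using Fun by blast
    then show ?thesis
      using finite_measure_mono[of H "F - ?U ?R"] URm S step.prems(4)
      by (simp add: measure_le_0_iff)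
  qed
  have side: "yao_frame u (k - 1) H (distr (restr N S) borel p) c ((\<lambda>(A, B). A \<union> B) ` R')
      \<and> measure N S = 2 ^ (k - 1 - 1) * m"
    if S': "S = Hp \<and> R' = Rp \<or> S = Hm \<and> R' = Rm"
      and ab: "ab_partition \<alpha> \<beta> u (k - 1) H N' c R'"
      and IH: "\<And>N. finite_measure N \<Longrightarrow> sets N = sets borel \<Longrightarrow>
         \<forall>(A, B)\<in>R'. measure N (A \<union> B) = m \<Longrightarrow> measure N (H - ?U R') = 0 \<Longrightarrow>
         yao_frame u (k - 1) H N c ((\<lambda>(A, B). A \<union> B) ` R') \<and> measure N H = 2 ^ (k - 1 - 1) * m"
    for S R' N'
  proof -
    have Sm: "S \<in> sets N" using S S' by auto
    have SF: "S \<subseteq> F" using S' Fun by auto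
    then have SH: "p -` H \<inter> S = S" using step(13) by auto
    have D: "measure (distr (restr N S) borel p) X = measure N (p -` X \<inter> S)" if "X \<in> sets borel" for X
      using measure_distr_restr[OF Sm that pm] .
    have "\<forall>(A, B)\<in>R'. measure (distr (restr N S) borel p) (A \<union> B) = m"
    proof (intro ballI, unfold split_paired_all prod.case)
      fix A B assume AB: "(A, B) \<in> R'"
      then have "A \<union> B \<in> sets borel" using ab_partition_convex_borel[OF ab u step(4) k1] by auto
      moreover have "(p -` A \<inter> S, p -` B \<inter> S) \<in> ?R" using AB S' by (auto simp: lift_pairs_iff)
      from bspec[OF step.prems(3) this] have "measure N (p -` A \<inter> S \<union> p -` B \<inter> S) = m"
        by (simp only: prod.case)
      moreover have "p -` A \<inter> S \<union> p -` B \<inter> S = p -` (A \<union> B) \<inter> S" by auto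
      ultimately show "measure (distr (restr N S) borel p) (A \<union> B) = m" using D by simp
    qed
    moreover have "measure (distr (restr N S) borel p) (H - ?U R') = 0"
    proof -
      have b: "H - ?U R' \<in> sets borel" using Ub[OF ab] S(2) step.prems(2) by auto
      have "p -` (H - ?U R') \<inter> S \<subseteq> F - ?U ?R"
        unfolding UN_Un lift_pairs_Union using SF S' Fun(3) by auto
      then have "measure N (p -` (H - ?U R') \<inter> S) \<le> measure N (F - ?U ?R)"
        using URm S by (intro finite_measure_mono) auto
      then show ?thesis using D[OF b] step.prems(4) by (simp add: measure_le_0_iff)
    qed
    moreover have "measure (distr (restr N S) borel p) H = measure N S"
      using D[of H] SH S(2) step.prems(2) by simp
    ultimately show ?thesis
      using IH[OF finite_measure_distr_restr[OF \<open>finite_measure N\<close> Sm pm]] by simp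
  qed
  have sp: "yao_frame u (k - 1) H (distr (restr N Hp) borel p) c ((\<lambda>(A, B). A \<union> B) ` Rp)"
    "measure N Hp = 2 ^ (k - 1 - 1) * m"
    using side[OF disjI1[OF conjI[OF refl refl]] step(14) step.IH(1)] by blast+
  have sm: "yao_frame u (k - 1) H (distr (restr N Hm) borel p) c ((\<lambda>(A, B). A \<union> B) ` Rm)"
    "measure N Hm = 2 ^ (k - 1 - 1) * m"
    using side[OF disjI2[OF conjI[OF refl refl]] step(15) step.IH(2)] by blast+
  have "measure N F = measure N (Hp \<union> Hm) + measure N H"
    using Fun finite_measure_Union[of "Hp \<union> Hm" H] S by simp
  also have "measure N (Hp \<union> Hm) = measure N Hp + measure N Hm"
    using S Fun(3) by (intro finite_measure_Union) auto
  finally have NF: "measure N F = measure N Hp + measure N Hm" using H0 by simp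
  have pow: "(2::real) ^ (k - 1) = 2 * 2 ^ (k - 1 - 1)" using step(1) by (cases "k - 1") auto
  have NF2: "measure N F = 2 ^ (k - 1) * m"
    unfolding NF pow sp(2) sm(2) by simp
  have half: "measure N Hp = measure N F / 2" "measure N Hm = measure N F / 2"
    unfolding NF sp(2) sm(2) by simp_all
  have "yao_frame u k F N c
      ((\<lambda>C. p -` C \<inter> Hp) ` (\<lambda>(A, B). A \<union> B) ` Rp \<union> (\<lambda>C. p -` C \<inter> Hm) ` (\<lambda>(A, B). A \<union> B) ` Rm)"
    by (rule yao_frame.step[OF step(1,5-7) half step(10-12) sp(1) sm(1)])
  moreover have "(\<lambda>C. p -` C \<inter> S) ` (\<lambda>(A, B). A \<union> B) ` R' = (\<lambda>(A, B). A \<union> B) ` lift_pairs p S R'"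
    for S R' unfolding lift_pairs_def image_image by (intro image_cong) auto
  ultimately show ?case using NF2 by (simp only: image_Un simp_thms)
qed

section \<open>The lexicographic order of displacements modulo \<open>u 1\<close>\<close>

text \<open>The leading index \<open>j\<close> is kept as a parameter because a family of displacements with one common
  leading index either lifts all mass strictly in direction \<open>u k\<close> or leaves all heights fixed.\<close>

definition lex_pos :: "(nat \<Rightarrow> 'a::euclidean_space) \<Rightarrow> nat \<Rightarrow> 'a \<Rightarrow> bool" where
  "lex_pos u j w \<longleftrightarrow> j \<in> {2..DIM('a)} \<and> w \<bullet> u j > 0 \<and> (\<forall>i\<in>{j<..DIM('a)}. w \<bullet> u i = 0)"

lemma lex_pos_add:
  assumes "lex_pos u i w" "lex_pos u j w'"
  shows "lex_pos u (max i j) (w + w')"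
proof -
  consider "i < j" | "i = j" | "i > j" by linarith
  then show ?thesis using assms by cases (auto simp: lex_pos_def inner_add_left max_def)
qed

lemma lex_pos_scale: "lex_pos u j w \<Longrightarrow> t > 0 \<Longrightarrow> lex_pos u j (t *\<^sub>R w)"
  by (auto simp: lex_pos_def)

lemma lex_pos_add_null:
  fixes w :: "'a::euclidean_space"
  assumes "lex_pos u j w" "\<forall>i\<in>{2..DIM('a)}. y \<bullet> u i = 0"
  shows "lex_pos u j (w + y)"
  using assms by (auto simp: lex_pos_def inner_add_left)

lemma lex_pos_antisym:
  assumes i: "lex_pos u i w"
  shows "\<not> lex_pos u j (- w)"
proof
  assume j: "lex_pos u j (- w)"
  consider "i < j" | "i = j" | "j < i" by linarith
  then show False
  proof cases
    case 1
    then have "w \<bullet> u j = 0" using i j unfolding lex_pos_def by simp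
    then show False using j unfolding lex_pos_def by simp
  next
    case 2
    then show False using i j unfolding lex_pos_def by simp
  next
    case 3
    then have "- w \<bullet> u i = 0" using i j unfolding lex_pos_def by simp
    then show False using i unfolding lex_pos_def by simp
  qed
qed

text \<open>Trichotomy, where the first case takes the place of zero; for an orthonormal
  \<open>u\<close> it consists of the multiples of \<open>u 1\<close>.\<close>

lemma lex_pos_cases:
  fixes w :: "'a::euclidean_space"
  obtains "\<forall>i\<in>{2..DIM('a)}. w \<bullet> u i = 0" | i where "lex_pos u i w" | i where "lex_pos u i (- w)"
proof -
  define I where "I = {i\<in>{2..DIM('a)}. w \<bullet> u i \<noteq> 0}"
  show thesis
  proof (cases "I = {}")
    case True
    then show thesis using that(1) unfolding I_def by blast
  next
    case False
    define m where "m = Max I"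
    have fin: "finite I" by (simp add: I_def)
    have m: "m \<in> {2..DIM('a)}" "w \<bullet> u m \<noteq> 0" using Max_in[OF fin False] by (auto simp: m_def I_def)
    have above: "w \<bullet> u i = 0" if i: "i \<in> {m<..DIM('a)}" for i
    proof (rule ccontr)
      assume "w \<bullet> u i \<noteq> 0"
      then have "i \<in> I" using i m unfolding I_def by simp
      then have "i \<le> m" unfolding m_def using fin by simp
      then show False using i by simp
    qed
    show thesis
    proof (cases "w \<bullet> u m > 0")
      case True
      then have "lex_pos u m w" using m above unfolding lex_pos_def by blast
      then show thesis using that(2) by blast
    next
      case False
      then have "lex_pos u m (- w)" using m above unfolding lex_pos_def by simp
      then show thesis using that(3) by blast
    qed
  qed
qed

text \<open>Restricting to \<open>B = \<Union> B\<^sub>i\<close> destroys positivity on open sets, but not on the open sets which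
  are closed under translation by positive multiples of \<open>u 1\<close>.\<close>

definition admissible :: "(nat \<Rightarrow> 'a::euclidean_space) \<Rightarrow> 'a measure \<Rightarrow> bool" where
  "admissible u M \<longleftrightarrow> finite_measure M \<and> sets M = sets borel \<and> absolutely_continuous lborel M \<and>
     (\<forall>A. open A \<longrightarrow> A \<noteq> {} \<longrightarrow> (\<forall>x\<in>A. \<forall>s\<ge>0. x + s *\<^sub>R u 1 \<in> A) \<longrightarrow> measure M A > 0)"

text \<open>The coupling of the ambient space with a flat. Continuity and openness make sets cut out
  by strict inequalities on heights open, and invariance along \<open>u 1\<close> makes them
  eligible for the positivity in \<open>admissible\<close>. Surjectivity supplies points of any
  prescribed height. Commuting with translations along the basis lets the coupling pass to the next
  flat.\<close>

definition flat_cover :: "(nat \<Rightarrow> 'a::euclidean_space) \<Rightarrow> nat \<Rightarrow> 'a set \<Rightarrow> 'a set \<Rightarrow> ('a \<Rightarrow> 'a) \<Rightarrow> bool" where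
  "flat_cover u k F \<Omega> f \<longleftrightarrow> open \<Omega> \<and> (\<forall>x\<in>\<Omega>. \<forall>s. x + s *\<^sub>R u 1 \<in> \<Omega>) \<and>
     continuous_on UNIV f \<and> f ` \<Omega> = F \<and> (\<forall>x s. \<forall>i\<in>{1..k}. f (x + s *\<^sub>R u i) = f x + s *\<^sub>R u i)"

lemma flat_cover_measurable: "flat_cover u k F \<Omega> f \<Longrightarrow> f \<in> borel_measurable borel"
  by (auto simp: flat_cover_def intro: borel_measurable_continuous_onI)

lemma measure_distr_flat_cover:
  assumes "sets M = sets borel" "flat_cover u k F \<Omega> f" "X \<in> sets borel"
  shows "measure (distr (restr M \<Omega>) borel f) X = measure M {x \<in> \<Omega>. f x \<in> X}"
proof -
  have "f \<in> M \<rightarrow>\<^sub>M borel" using flat_cover_measurable[OF assms(2)] measurable_cong_sets[OF assms(1) refl] by blast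
  moreover have "\<Omega> \<in> sets M" using assms by (simp add: flat_cover_def)
  moreover have "f -` X \<inter> \<Omega> = {x \<in> \<Omega>. f x \<in> X}" by auto
  ultimately show ?thesis using measure_distr_restr[of \<Omega> M X f] assms(3) by simp
qed

lemma flat_cover_attains:
  fixes u :: "nat \<Rightarrow> 'a::euclidean_space"
  assumes u: "orthonormal_basis u" and F: "flat u k F" and k: "1 \<le> k" "k \<le> DIM('a)"
    and c: "flat_cover u k F \<Omega> f"
  obtains x where "x \<in> \<Omega>" "f x \<bullet> u k = r"
proof -
  obtain y where y: "y \<in> F" using flat_nonempty[OF u F] by blast
  have kk: "u k \<bullet> u k = 1" using orthonormal_inner[OF u, of k k] k by simp
  have "y + (r - y \<bullet> u k) *\<^sub>R u k \<in> f ` \<Omega>"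
    using flat_add_basis[OF u F y, of k] k c by (simp add: flat_cover_def)
  then obtain x where "x \<in> \<Omega>" "f x = y + (r - y \<bullet> u k) *\<^sub>R u k" by auto
  then show thesis using that by (simp add: inner_add_left kk)
qed

section \<open>Monotonicity of the halving height\<close>

text \<open>Moving mass upwards in direction \<open>u k\<close> cannot lower the halving hyperplane: otherwise the points
  which cross from below \<open>h\<close> to above \<open>h'\<close> would form an open set of measure zero.\<close>

lemma halving_height_crossing:
  fixes u :: "nat \<Rightarrow> 'a::euclidean_space"
  assumes u: "orthonormal_basis u" and M: "admissible u M" and F: "flat u k F"
    and k: "2 \<le> k" "k \<le> DIM('a)" and c: "flat_cover u k F \<Omega> f" "flat_cover u k F \<Omega> f'"
    and h: "measure (distr (restr M \<Omega>) borel f) {x \<in> F. x \<bullet> u k > h} =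
        measure (distr (restr M \<Omega>) borel f) F / 2"
    and h': "measure (distr (restr M \<Omega>) borel f') {x \<in> F. x \<bullet> u k > h'} =
        measure (distr (restr M \<Omega>) borel f') F / 2"
    and up: "\<And>x. x \<in> \<Omega> \<Longrightarrow> f x \<bullet> u k \<le> f' x \<bullet> u k" and "h' \<le> h"
    and x: "x \<in> \<Omega>" "f x \<bullet> u k < h" "h' < f' x \<bullet> u k"
  shows False
proof -
  have sets: "sets M = sets borel" and fin: "finite_measure M" using M by (auto simp: admissible_def)
  interpret finite_measure M by fact
  have img: "f x \<in> F" "f' x \<in> F" if "x \<in> \<Omega>" for x using c that by (auto simp: flat_cover_def)
  have "{x \<in> \<Omega>. f x \<in> F} = \<Omega>" "{x \<in> \<Omega>. f' x \<in> F} = \<Omega>" using img by auto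
  then have tot: "measure (distr (restr M \<Omega>) borel f) F = measure M \<Omega>"
    "measure (distr (restr M \<Omega>) borel f') F = measure M \<Omega>"
    using measure_distr_flat_cover[OF sets] c flat_borel[OF F] by auto
  define U where "U = {x \<in> \<Omega>. f x \<bullet> u k > h}"
  define U' where "U' = {x \<in> \<Omega>. f' x \<bullet> u k > h'}"
  define E where "E = {x \<in> \<Omega>. f x \<bullet> u k < h \<and> f' x \<bullet> u k > h'}"
  have "{x \<in> \<Omega>. f x \<in> {x \<in> F. x \<bullet> u k > h}} = U" "{x \<in> \<Omega>. f' x \<in> {x \<in> F. x \<bullet> u k > h'}} = U'"
    using img by (auto simp: U_def U'_def)
  then have "measure (distr (restr M \<Omega>) borel f) {x \<in> F. x \<bullet> u k > h} = measure M U"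
    "measure (distr (restr M \<Omega>) borel f') {x \<in> F. x \<bullet> u k > h'} = measure M U'"
    using measure_distr_flat_cover[OF sets c(1) sides_borel(1)[OF F, of h "u k"]]
      measure_distr_flat_cover[OF sets c(2) sides_borel(1)[OF F, of h' "u k"]] by simp_all
  then have meas: "measure M U = measure M U'" using h h' tot by simp
  have cont: "continuous_on UNIV (\<lambda>x. f x \<bullet> u k)" "continuous_on UNIV (\<lambda>x. f' x \<bullet> u k)" "open \<Omega>"
    using c by (auto simp: flat_cover_def intro!: continuous_intros)
  have op: "open U" "open U'" "open E"
  proof -
    have "open {x. h < f x \<bullet> u k}" "open {x. f x \<bullet> u k < h}" "open {x. h' < f' x \<bullet> u k}"
      by (intro open_Collect_less cont continuous_on_const)+
    moreover have "U = \<Omega> \<inter> {x. h < f x \<bullet> u k}" "U' = \<Omega> \<inter> {x. h' < f' x \<bullet> u k}"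
      "E = \<Omega> \<inter> {x. f x \<bullet> u k < h} \<inter> {x. h' < f' x \<bullet> u k}"
      by (auto simp: U_def U'_def E_def)
    ultimately show "open U" "open U'" "open E" using cont(3) by (auto intro: open_Int)
  qed
  have 1: "u 1 \<bullet> u k = 0" using orthonormal_inner[OF u, of 1 k] k by auto
  \<comment> \<open>Neither height changes along \<open>u 1\<close>, which puts \<open>E\<close>
    among the open sets to which \<open>admissible\<close> gives positive measure.\<close>
  have sh: "f (x + s *\<^sub>R u 1) \<bullet> u k = f x \<bullet> u k" "f' (x + s *\<^sub>R u 1) \<bullet> u k = f' x \<bullet> u k" for x s
  proof -
    have "f (x + s *\<^sub>R u 1) = f x + s *\<^sub>R u 1" "f' (x + s *\<^sub>R u 1) = f' x + s *\<^sub>R u 1"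
      using c k unfolding flat_cover_def by (meson atLeastAtMost_iff le_refl one_le_numeral order_trans)+
    then show "f (x + s *\<^sub>R u 1) \<bullet> u k = f x \<bullet> u k" "f' (x + s *\<^sub>R u 1) \<bullet> u k = f' x \<bullet> u k"
      using 1 by (simp_all add: inner_add_left)
  qed
  have "\<forall>x\<in>\<Omega>. \<forall>s. x + s *\<^sub>R u 1 \<in> \<Omega>" using c(1) unfolding flat_cover_def by blast
  then have "\<forall>x\<in>E. \<forall>s\<ge>0. x + s *\<^sub>R u 1 \<in> E" unfolding E_def using sh by simp
  moreover have "E \<noteq> {}" using x by (auto simp: E_def)
  ultimately have "measure M E > 0" using M op(3) unfolding admissible_def by blast
  moreover have "U \<union> E \<subseteq> U'" using up \<open>h' \<le> h\<close> by (fastforce simp: U_def E_def U'_def)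
  then have "measure M (U \<union> E) \<le> measure M U'" using op sets by (intro finite_measure_mono) auto
  moreover have "measure M (U \<union> E) = measure M U + measure M E"
    using op sets by (intro finite_measure_Union) (auto simp: U_def E_def)
  ultimately show False using meas by simp
qed

lemma halving_height_mono:
  fixes u :: "nat \<Rightarrow> 'a::euclidean_space"
  assumes u: "orthonormal_basis u" and M: "admissible u M" and F: "flat u k F"
    and k: "2 \<le> k" "k \<le> DIM('a)" and c: "flat_cover u k F \<Omega> f" "flat_cover u k F \<Omega> f'"
    and h: "measure (distr (restr M \<Omega>) borel f) {x \<in> F. x \<bullet> u k > h} =
        measure (distr (restr M \<Omega>) borel f) F / 2"
    and h': "measure (distr (restr M \<Omega>) borel f') {x \<in> F. x \<bullet> u k > h'} =
        measure (distr (restr M \<Omega>) borel f') F / 2"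
    and up: "\<And>x. x \<in> \<Omega> \<Longrightarrow> f x \<bullet> u k \<le> f' x \<bullet> u k"
  shows "h \<le> h'"
proof (rule ccontr)
  assume "\<not> h \<le> h'"
  then have hh: "h' < h" by simp
  \<comment> \<open>Strictly between the two heights: below \<open>h\<close> under \<open>f\<close>,
    and above \<open>h'\<close> under \<open>f'\<close>, which is at least as high.\<close>
  obtain x where x: "x \<in> \<Omega>" "f x \<bullet> u k = (h + h') / 2"
    using flat_cover_attains[OF u F _ k(2) c(1)] k by (metis one_le_numeral order_trans)
  show False
    by (rule halving_height_crossing[OF u M F k c h h' up _ x(1)]) (use x hh up[OF x(1)] in auto)
qed

lemma halving_height_strict_mono:
  fixes u :: "nat \<Rightarrow> 'a::euclidean_space"
  assumes u: "orthonormal_basis u" and M: "admissible u M" and F: "flat u k F"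
    and k: "2 \<le> k" "k \<le> DIM('a)" and c: "flat_cover u k F \<Omega> f" "flat_cover u k F \<Omega> f'"
    and h: "measure (distr (restr M \<Omega>) borel f) {x \<in> F. x \<bullet> u k > h} =
        measure (distr (restr M \<Omega>) borel f) F / 2"
    and h': "measure (distr (restr M \<Omega>) borel f') {x \<in> F. x \<bullet> u k > h'} =
        measure (distr (restr M \<Omega>) borel f') F / 2"
    and up: "\<And>x. x \<in> \<Omega> \<Longrightarrow> f x \<bullet> u k < f' x \<bullet> u k"
  shows "h < h'"
proof (rule ccontr)
  assume "\<not> h < h'"
  then have hh: "h' \<le> h" by simp
  have kk: "u k \<bullet> u k = 1" using orthonormal_inner[OF u, of k k] k by simp
  obtain x where x: "x \<in> \<Omega>" "f x \<bullet> u k = h"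
    using flat_cover_attains[OF u F _ k(2) c(1)] k by (metis one_le_numeral order_trans)
  have sh: "f (x + s *\<^sub>R u k) \<bullet> u k = f x \<bullet> u k + s" "f' (x + s *\<^sub>R u k) \<bullet> u k = f' x \<bullet> u k + s" for s
    using c k by (auto simp: flat_cover_def inner_add_left kk)
  have "open \<Omega>" using c(1) by (simp add: flat_cover_def)
  then obtain \<epsilon> where e: "\<epsilon> > 0" "ball x \<epsilon> \<subseteq> \<Omega>" using x(1) open_contains_ball by blast
  \<comment> \<open>Lowering a point of height \<open>h\<close> by \<delta> brings it strictly below
    \<open>h\<close>. Half the radius keeps it in \<Omega>, and half the gap keeps its image under
    \<open>f'\<close> above \<open>h\<close>, hence above \<open>h'\<close>.\<close>
  define \<delta> where "\<delta> = min (\<epsilon> / 2) ((f' x \<bullet> u k - h) / 2)"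
  have d: "\<delta> > 0" "\<delta> < \<epsilon>" "\<delta> < f' x \<bullet> u k - h"
    using e(1) up[OF x(1)] x(2) by (auto simp: \<delta>_def min_def)
  have "norm (u k) = 1" using kk by (simp add: norm_eq_sqrt_inner)
  then have y\<Omega>: "x + (- \<delta>) *\<^sub>R u k \<in> \<Omega>" using e(2) d by (auto simp: dist_norm)
  show False
    by (rule halving_height_crossing[OF u M F k c h h' less_imp_le[OF up] hh y\<Omega>])
      (use sh[of "- \<delta>"] d x hh in auto)
qed

text \<open>The sign of \<sigma> selects the side, so one statement serves both. The coupling
  survives because the projection commutes with translations along the remaining basis vectors; the
  second claim removes the nested image measure.\<close>

lemma flat_cover_side:
  fixes u :: "nat \<Rightarrow> 'a::euclidean_space" and \<sigma> :: real
  assumes u: "orthonormal_basis u" and M: "sets M = sets borel" and F: "flat u k F"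
    and k: "2 \<le> k" "k \<le> DIM('a)" and c: "flat_cover u k F \<Omega> f"
    and v: "v \<in> span (u ` {1..k})" "v \<bullet> u k \<noteq> 0" and \<sigma>: "\<sigma> \<noteq> 0"
    and \<Omega>': "\<Omega>' = {x \<in> \<Omega>. \<sigma> * (f x \<bullet> u k - h) > 0}"
  shows "flat_cover u (k - 1) {x \<in> F. x \<bullet> u k = h} \<Omega>' (\<lambda>x. proj_along (u k) h v (f x))"
    "distr (restr (distr (restr M \<Omega>) borel f) {x \<in> F. \<sigma> * (x \<bullet> u k - h) > 0}) borel
       (proj_along (u k) h v) = distr (restr M \<Omega>') borel (\<lambda>x. proj_along (u k) h v (f x))"
proof -
  let ?p = "proj_along (u k) h v"
  have k1: "1 \<le> k" using k by simp
  have img: "f ` \<Omega> = F" and op: "open \<Omega>" and inv: "\<And>x s. x \<in> \<Omega> \<Longrightarrow> x + s *\<^sub>R u 1 \<in> \<Omega>"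
    and cont: "continuous_on UNIV f"
    and sh: "\<And>x s i. i \<in> {1..k} \<Longrightarrow> f (x + s *\<^sub>R u i) = f x + s *\<^sub>R u i"
    using c unfolding flat_cover_def by blast+
  have orth: "u i \<bullet> u k = 0" if "i \<in> {1..k - 1}" for i
    using orthonormal_inner[OF u, of i k] that k by auto
  have "open {x. 0 < \<sigma> * (f x \<bullet> u k - h)}"
    by (intro open_Collect_less continuous_intros cont)
  moreover have \<Omega>'': "\<Omega>' = \<Omega> \<inter> {x. 0 < \<sigma> * (f x \<bullet> u k - h)}" using \<Omega>' by auto
  ultimately have op': "open \<Omega>'" using op by (simp add: open_Int)
  have inv': "x + s *\<^sub>R u 1 \<in> \<Omega>'" if "x \<in> \<Omega>'" for x s
    using that inv[of x s] sh[of 1 x s] orth[of 1] k unfolding \<Omega>' by (auto simp: inner_add_left)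
  have img': "(\<lambda>x. ?p (f x)) ` \<Omega>' = {x \<in> F. x \<bullet> u k = h}"
  proof
    show "(\<lambda>x. ?p (f x)) ` \<Omega>' \<subseteq> {x \<in> F. x \<bullet> u k = h}"
      using proj_along_mem_section[OF u F k1 k(2) v] img unfolding \<Omega>' by blast
    show "{x \<in> F. x \<bullet> u k = h} \<subseteq> (\<lambda>x. ?p (f x)) ` \<Omega>'"
    proof
      fix y assume y: "y \<in> {x \<in> F. x \<bullet> u k = h}"
      \<comment> \<open>The point on the fibre over \<open>y\<close> with signed height \<sigma>; it
        lies on the chosen side because \<sigma> * \<sigma> > 0.\<close>
      let ?y = "y + (\<sigma> / (v \<bullet> u k)) *\<^sub>R v"
      have yk: "?y \<bullet> u k = h + \<sigma>" using y v by (simp add: inner_add_left)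
      have "?y \<in> F" using y span_inner_zero[OF u v(1) k(2)]
        by (rule_tac flat_memI[OF F, of y]) (simp_all add: inner_add_left)
      then have "?y \<in> f ` \<Omega>" unfolding img .
      then obtain x where x: "x \<in> \<Omega>" "f x = ?y" by (elim imageE) simp
      have "\<sigma> * \<sigma> > 0" using \<sigma> not_real_square_gt_zero by blast
      then have "x \<in> \<Omega>'" using x yk unfolding \<Omega>' by simp
      moreover have "?p (f x) = y" unfolding proj_along_def x(2) yk by simp
      ultimately show "y \<in> (\<lambda>x. ?p (f x)) ` \<Omega>'" by force
    qed
  qed
  have sh': "?p (f (x + s *\<^sub>R u i)) = ?p (f x) + s *\<^sub>R u i" if "i \<in> {1..k - 1}" for x s i
    using that sh[of i x s] orth[OF that] by (auto simp: proj_along_add)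
  show "flat_cover u (k - 1) {x \<in> F. x \<bullet> u k = h} \<Omega>' (\<lambda>x. ?p (f x))"
    unfolding flat_cover_def using op' inv' img' sh' cont by (auto intro!: continuous_intros)
  have S: "{x \<in> F. \<sigma> * (x \<bullet> u k - h) > 0} \<in> sets borel"
  proof -
    have "{x. \<sigma> * (x \<bullet> u k - h) > 0} \<in> sets borel" by measurable
    moreover have "{x \<in> F. \<sigma> * (x \<bullet> u k - h) > 0} = F \<inter> {x. \<sigma> * (x \<bullet> u k - h) > 0}" by auto
    ultimately show ?thesis using flat_borel[OF F] by simp
  qed
  have "\<Omega> \<inter> f -` {x \<in> F. \<sigma> * (x \<bullet> u k - h) > 0} = \<Omega>'" using img unfolding \<Omega>' by auto
  then show "distr (restr (distr (restr M \<Omega>) borel f) {x \<in> F. \<sigma> * (x \<bullet> u k - h) > 0}) borel ?p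
      = distr (restr M \<Omega>') borel (\<lambda>x. ?p (f x))"
    using distr_restr_distr_restr[OF M _ S flat_cover_measurable[OF c] proj_along_measurable, of \<Omega>] op
    by simp
qed

section \<open>Comparison of two coupled frames\<close>

lemma yao_frame_height:
  assumes "yao_frame u k F N c CC" "2 \<le> k"
  shows "\<exists>h. measure N {x \<in> F. x \<bullet> u k > h} = measure N F / 2 \<and> c \<in> {x \<in> F. x \<bullet> u k = h}"
  using assms(1)
proof (cases rule: yao_frame.cases)
  case line
  then show ?thesis using assms(2) by simp
next
  case (step H h Hp Hm v p Cp Cm)
  have "c \<in> H" using yao_frame_center[OF step(11)] .
  then show ?thesis using step(3,4,6) by (intro exI[of _ h]) simp
qed

lemma yao_frame_stepE:
  assumes "yao_frame u k F N c CC" "2 \<le> k"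
  obtains h v Cp Cm where
    "measure N {x \<in> F. x \<bullet> u k > h} = measure N F / 2" "v \<in> span (u ` {1..k})" "v \<bullet> u k \<noteq> 0"
    "yao_frame u (k - 1) {x \<in> F. x \<bullet> u k = h}
       (distr (restr N {x \<in> F. x \<bullet> u k > h}) borel (proj_along (u k) h v)) c Cp"
    "yao_frame u (k - 1) {x \<in> F. x \<bullet> u k = h}
       (distr (restr N {x \<in> F. x \<bullet> u k < h}) borel (proj_along (u k) h v)) c Cm"
    "CC = (\<lambda>C. proj_along (u k) h v -` C \<inter> {x \<in> F. x \<bullet> u k > h}) ` Cp \<union>
       (\<lambda>C. proj_along (u k) h v -` C \<inter> {x \<in> F. x \<bullet> u k < h}) ` Cm"
  using assms(1)
proof (cases rule: yao_frame.cases)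
  case line
  then show thesis using assms(2) by simp
next
  case (step H h Hp Hm v p Cp Cm)
  then show thesis using that[of h v Cp Cm] by simp
qed

text \<open>Both frames are halved at the same height. Replacing the projection vector of the first by that of
  the second shifts the upper half along \<open>- e\<close> and the lower half along \<open>e\<close>.\<close>

lemma yao_frame_step_coupled:
  fixes u :: "nat \<Rightarrow> 'a::euclidean_space"
  assumes u: "orthonormal_basis u" and M: "admissible u M" and F: "flat u k F"
    and k: "2 \<le> k" "k \<le> DIM('a)" and c: "flat_cover u k F \<Omega> f" "flat_cover u k F \<Omega> f'"
    and eq: "\<And>x. x \<in> \<Omega> \<Longrightarrow> f' x \<bullet> u k = f x \<bullet> u k"
    and fr: "yao_frame u k F (distr (restr M \<Omega>) borel f) c CC"
      "yao_frame u k F (distr (restr M \<Omega>) borel f') c' CC'"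
  obtains H \<Omega>p g g' \<Omega>m Cp Cm Cp' Cm' e h v' v where
    "flat u (k - 1) H"
    "flat_cover u (k - 1) H \<Omega>p g" "flat_cover u (k - 1) H \<Omega>p g'"
    "flat_cover u (k - 1) H \<Omega>m g" "flat_cover u (k - 1) H \<Omega>m g'"
    "yao_frame u (k - 1) H (distr (restr M \<Omega>p) borel g) c Cp"
    "yao_frame u (k - 1) H (distr (restr M \<Omega>m) borel g) c Cm"
    "yao_frame u (k - 1) H (distr (restr M \<Omega>p) borel g') c' Cp'"
    "yao_frame u (k - 1) H (distr (restr M \<Omega>m) borel g') c' Cm'"
    "\<Omega>p \<subseteq> \<Omega>" "\<Omega>m \<subseteq> \<Omega>"
    "\<forall>x\<in>\<Omega>p. \<exists>t>0. g' x - g x = f' x - f x + t *\<^sub>R (- e)"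
    "\<forall>x\<in>\<Omega>m. \<exists>t>0. g' x - g x = f' x - f x + t *\<^sub>R e"
    "\<forall>x. \<exists>t. proj_along (u k) h v' x = proj_along (u k) h v x + t *\<^sub>R e"
    "CC = (\<lambda>C. proj_along (u k) h v -` C \<inter> {x \<in> F. x \<bullet> u k > h}) ` Cp \<union>
       (\<lambda>C. proj_along (u k) h v -` C \<inter> {x \<in> F. x \<bullet> u k < h}) ` Cm"
    "CC' = (\<lambda>C. proj_along (u k) h v' -` C \<inter> {x \<in> F. x \<bullet> u k > h}) ` Cp' \<union>
       (\<lambda>C. proj_along (u k) h v' -` C \<inter> {x \<in> F. x \<bullet> u k < h}) ` Cm'"
proof -
  have sets: "sets M = sets borel" using M by (simp add: admissible_def)
  obtain h v Cp Cm where 1: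
    "measure (distr (restr M \<Omega>) borel f) {x \<in> F. x \<bullet> u k > h} = measure (distr (restr M \<Omega>) borel f) F / 2"
    "v \<in> span (u ` {1..k})" "v \<bullet> u k \<noteq> 0"
    "yao_frame u (k - 1) {x \<in> F. x \<bullet> u k = h} (distr (restr (distr (restr M \<Omega>) borel f)
       {x \<in> F. x \<bullet> u k > h}) borel (proj_along (u k) h v)) c Cp"
    "yao_frame u (k - 1) {x \<in> F. x \<bullet> u k = h} (distr (restr (distr (restr M \<Omega>) borel f)
       {x \<in> F. x \<bullet> u k < h}) borel (proj_along (u k) h v)) c Cm"
    "CC = (\<lambda>C. proj_along (u k) h v -` C \<inter> {x \<in> F. x \<bullet> u k > h}) ` Cp \<union>
       (\<lambda>C. proj_along (u k) h v -` C \<inter> {x \<in> F. x \<bullet> u k < h}) ` Cm"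
    using fr(1) k(1) by (rule yao_frame_stepE)
  obtain h' v' Cp' Cm' where 2:
    "measure (distr (restr M \<Omega>) borel f') {x \<in> F. x \<bullet> u k > h'} = measure (distr (restr M \<Omega>) borel f') F / 2"
    "v' \<in> span (u ` {1..k})" "v' \<bullet> u k \<noteq> 0"
    "yao_frame u (k - 1) {x \<in> F. x \<bullet> u k = h'} (distr (restr (distr (restr M \<Omega>) borel f')
       {x \<in> F. x \<bullet> u k > h'}) borel (proj_along (u k) h' v')) c' Cp'"
    "yao_frame u (k - 1) {x \<in> F. x \<bullet> u k = h'} (distr (restr (distr (restr M \<Omega>) borel f')
       {x \<in> F. x \<bullet> u k < h'}) borel (proj_along (u k) h' v')) c' Cm'"
    "CC' = (\<lambda>C. proj_along (u k) h' v' -` C \<inter> {x \<in> F. x \<bullet> u k > h'}) ` Cp' \<union>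
       (\<lambda>C. proj_along (u k) h' v' -` C \<inter> {x \<in> F. x \<bullet> u k < h'}) ` Cm'"
    using fr(2) k(1) by (rule yao_frame_stepE)
  \<comment> \<open>The two maps agree in height, so monotonicity applies in both
    directions.\<close>
  have "h \<le> h'" by (rule halving_height_mono[OF u M F k c 1(1) 2(1)]) (simp add: eq)
  moreover have "h' \<le> h" by (rule halving_height_mono[OF u M F k c(2,1) 2(1) 1(1)]) (simp add: eq)
  ultimately have hh: "h' = h" by simp
  note 2 = 2[unfolded hh]
  let ?H = "{x \<in> F. x \<bullet> u k = h}"
  \<comment> \<open>The difference of the projection vectors after scaling both to height one. A
    point of signed height \<open>s\<close> over the section is displaced by
    \<open>- s *\<^sub>R e\<close>, which gives opposite directions on the two sides.\<close>
  define e where "e = (1 / (v' \<bullet> u k)) *\<^sub>R v' - (1 / (v \<bullet> u k)) *\<^sub>R v"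
  define g where "g x = proj_along (u k) h v (f x)" for x
  define g' where "g' x = proj_along (u k) h v' (f' x)" for x
  \<comment> \<open>The factors 1 and - 1 are the values of \<sigma> in
    \<open>flat_cover_side\<close>, written out to match its form.\<close>
  define \<Omega>p where "\<Omega>p = {x \<in> \<Omega>. 1 * (f x \<bullet> u k - h) > 0}"
  define \<Omega>m where "\<Omega>m = {x \<in> \<Omega>. - 1 * (f x \<bullet> u k - h) > 0}"
  have \<Omega>': "\<Omega>p = {x \<in> \<Omega>. 1 * (f' x \<bullet> u k - h) > 0}" "\<Omega>m = {x \<in> \<Omega>. - 1 * (f' x \<bullet> u k - h) > 0}"
    using eq by (auto simp: \<Omega>p_def \<Omega>m_def)
  have sides: "{x \<in> F. x \<bullet> u k > h} = {x \<in> F. 1 * (x \<bullet> u k - h) > 0}"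
    "{x \<in> F. x \<bullet> u k < h} = {x \<in> F. - 1 * (x \<bullet> u k - h) > 0}" by auto
  have one: "(1::real) \<noteq> 0" "(- 1::real) \<noteq> 0" by auto
  note cp = flat_cover_side[OF u sets F k c(1) 1(2,3) one(1) \<Omega>p_def, folded g_def]
    and cm = flat_cover_side[OF u sets F k c(1) 1(2,3) one(2) \<Omega>m_def, folded g_def]
    and cp' = flat_cover_side[OF u sets F k c(2) 2(2,3) one(1) \<Omega>'(1), folded g'_def]
    and cm' = flat_cover_side[OF u sets F k c(2) 2(2,3) one(2) \<Omega>'(2), folded g'_def]
  have disp: "g' x - g x = f' x - f x + (- (f x \<bullet> u k - h)) *\<^sub>R e" if "x \<in> \<Omega>" for x
    unfolding g_def g'_def proj_along_def eq[OF that] e_def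
    by (simp add: algebra_simps add_divide_distrib diff_divide_distrib)
  have disp': "g' x - g x = f' x - f x + (f x \<bullet> u k - h) *\<^sub>R (- e)" if "x \<in> \<Omega>" for x
    using disp[OF that] by (simp only: scaleR_minus_left scaleR_minus_right)
  show thesis
  proof (rule that)
    show "flat u (k - 1) ?H" using flat_section[OF F _ k(2)] k by simp
    show "flat_cover u (k - 1) ?H \<Omega>p g" using cp(1) .
    show "flat_cover u (k - 1) ?H \<Omega>p g'" using cp'(1) .
    show "flat_cover u (k - 1) ?H \<Omega>m g" using cm(1) .
    show "flat_cover u (k - 1) ?H \<Omega>m g'" using cm'(1) .
    show "yao_frame u (k - 1) ?H (distr (restr M \<Omega>p) borel g) c Cp"
      using 1(4) unfolding sides cp(2) .
    show "yao_frame u (k - 1) ?H (distr (restr M \<Omega>m) borel g) c Cm"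
      using 1(5) unfolding sides cm(2) .
    show "yao_frame u (k - 1) ?H (distr (restr M \<Omega>p) borel g') c' Cp'"
      using 2(4) unfolding sides cp'(2) .
    show "yao_frame u (k - 1) ?H (distr (restr M \<Omega>m) borel g') c' Cm'"
      using 2(5) unfolding sides cm'(2) .
    show "\<Omega>p \<subseteq> \<Omega>" "\<Omega>m \<subseteq> \<Omega>" by (auto simp: \<Omega>p_def \<Omega>m_def)
    show "\<forall>x\<in>\<Omega>p. \<exists>t>0. g' x - g x = f' x - f x + t *\<^sub>R (- e)"
    proof
      fix x assume "x \<in> \<Omega>p"
      then show "\<exists>t>0. g' x - g x = f' x - f x + t *\<^sub>R (- e)"
        using disp'[of x] unfolding \<Omega>p_def by (intro exI[of _ "f x \<bullet> u k - h"] conjI) simp_all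
    qed
    show "\<forall>x\<in>\<Omega>m. \<exists>t>0. g' x - g x = f' x - f x + t *\<^sub>R e"
    proof
      fix x assume "x \<in> \<Omega>m"
      then show "\<exists>t>0. g' x - g x = f' x - f x + t *\<^sub>R e"
        using disp[of x] unfolding \<Omega>m_def
        by (intro exI[of _ "- (f x \<bullet> u k - h)"] conjI) simp_all
    qed
    show "\<forall>x. \<exists>t. proj_along (u k) h v' x = proj_along (u k) h v x + t *\<^sub>R e"
    proof
      fix x
      show "\<exists>t. proj_along (u k) h v' x = proj_along (u k) h v x + t *\<^sub>R e"
        unfolding proj_along_def e_def
        by (intro exI[of _ "- (x \<bullet> u k - h)"]) (simp add: algebra_simps add_divide_distrib diff_divide_distrib)
    qed
  qed (fact 1(6) 2(6))+
qed

text \<open>If the leading index is that of the flat, all mass rises strictly, and with it the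
  halving height, which is the top coordinate of the center. Otherwise the heights agree, and the
  change of projection adds a positive multiple of \<open>- e\<close> above and of \<open>e\<close>
  below. On one of the halves this addition does not work against the displacement, and that half
  suffices, because both halves have the same center.\<close>

lemma yao_frame_center_mono:
  fixes u :: "nat \<Rightarrow> 'a::euclidean_space"
  assumes u: "orthonormal_basis u" and M: "admissible u M"
  shows "flat u k F \<Longrightarrow> 1 \<le> k \<Longrightarrow> k \<le> DIM('a) \<Longrightarrow> flat_cover u k F \<Omega> f \<Longrightarrow> flat_cover u k F \<Omega> f' \<Longrightarrow>
    (\<And>x. x \<in> \<Omega> \<Longrightarrow> lex_pos u j (f' x - f x)) \<Longrightarrow>
    yao_frame u k F (distr (restr M \<Omega>) borel f) c CC \<Longrightarrow>
    yao_frame u k F (distr (restr M \<Omega>) borel f') c' CC' \<Longrightarrow> \<exists>i. lex_pos u i (c' - c)"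
proof (induction k arbitrary: F \<Omega> f f' j CC CC')
  case 0
  then show ?case by simp
next
  case (Suc k)
  note F = Suc.prems(1) and cp = Suc.prems(4,5) and pos = Suc.prems(6) and fr = Suc.prems(7,8)
  have img: "f x \<in> F" "f' x \<in> F" if "x \<in> \<Omega>" for x using cp that by (auto simp: flat_cover_def)
  obtain x0 where x0: "x0 \<in> \<Omega>" using flat_cover_attains[OF u F Suc.prems(2,3) cp(1)] by blast
  \<comment> \<open>Both images lie in \<open>F\<close>, so the displacement vanishes in all
    coordinates beyond those of the flat.\<close>
  have j: "2 \<le> j" "j \<le> Suc k"
  proof -
    show "2 \<le> j" using pos[OF x0] by (simp add: lex_pos_def)
    show "j \<le> Suc k"
    proof (rule ccontr)
      assume "\<not> j \<le> Suc k"
      then have "f' x0 \<bullet> u j = f x0 \<bullet> u j"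
        using pos[OF x0] img[OF x0] by (intro flat_inner_eq[OF F]) (auto simp: lex_pos_def)
      then show False using pos[OF x0] by (simp add: lex_pos_def inner_diff_left)
    qed
  qed
  then have k2: "2 \<le> Suc k" by simp
  show ?case
  proof (cases "j = Suc k")
    case True
    obtain h where h: "measure (distr (restr M \<Omega>) borel f) {x \<in> F. x \<bullet> u (Suc k) > h} =
        measure (distr (restr M \<Omega>) borel f) F / 2" "c \<in> {x \<in> F. x \<bullet> u (Suc k) = h}"
      using yao_frame_height[OF fr(1) k2] by blast
    obtain h' where h': "measure (distr (restr M \<Omega>) borel f') {x \<in> F. x \<bullet> u (Suc k) > h'} =
        measure (distr (restr M \<Omega>) borel f') F / 2" "c' \<in> {x \<in> F. x \<bullet> u (Suc k) = h'}"
      using yao_frame_height[OF fr(2) k2] by blast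
    have "h < h'"
      using halving_height_strict_mono[OF u M F k2 Suc.prems(3) cp h(1) h'(1)] pos True
      by (auto simp: lex_pos_def inner_diff_left)
    moreover have "c' \<bullet> u i = c \<bullet> u i" if "i \<in> {Suc k<..DIM('a)}" for i
      using flat_inner_eq[OF F _ _ that] h(2) h'(2) by auto
    ultimately have "lex_pos u (Suc k) (c' - c)"
      using h(2) h'(2) k2 Suc.prems(3) by (auto simp: lex_pos_def inner_diff_left)
    then show ?thesis by blast
  next
    case False
    then have jk: "j < Suc k" and k1: "1 \<le> k" "k \<le> DIM('a)" using j Suc.prems(3) by auto
    have eq: "f' x \<bullet> u (Suc k) = f x \<bullet> u (Suc k)" if "x \<in> \<Omega>" for x
      using pos[OF that] jk Suc.prems(3) by (auto simp: lex_pos_def inner_diff_left)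
    obtain H \<Omega>p g g' \<Omega>m Cp Cm Cp' Cm' e h v' v where
      H: "flat u (Suc k - 1) H" and
      c: "flat_cover u (Suc k - 1) H \<Omega>p g" "flat_cover u (Suc k - 1) H \<Omega>p g'"
        "flat_cover u (Suc k - 1) H \<Omega>m g" "flat_cover u (Suc k - 1) H \<Omega>m g'" and
      fr': "yao_frame u (Suc k - 1) H (distr (restr M \<Omega>p) borel g) c Cp"
        "yao_frame u (Suc k - 1) H (distr (restr M \<Omega>m) borel g) c Cm"
        "yao_frame u (Suc k - 1) H (distr (restr M \<Omega>p) borel g') c' Cp'"
        "yao_frame u (Suc k - 1) H (distr (restr M \<Omega>m) borel g') c' Cm'" and
      sub: "\<Omega>p \<subseteq> \<Omega>" "\<Omega>m \<subseteq> \<Omega>" and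
      dp: "\<forall>x\<in>\<Omega>p. \<exists>t>0. g' x - g x = f' x - f x + t *\<^sub>R (- e)" and
      dm: "\<forall>x\<in>\<Omega>m. \<exists>t>0. g' x - g x = f' x - f x + t *\<^sub>R e" and
      "\<forall>x. \<exists>t. proj_along (u (Suc k)) h v' x = proj_along (u (Suc k)) h v x + t *\<^sub>R e" and
      "CC = (\<lambda>C. proj_along (u (Suc k)) h v -` C \<inter> {x \<in> F. x \<bullet> u (Suc k) > h}) ` Cp \<union>
        (\<lambda>C. proj_along (u (Suc k)) h v -` C \<inter> {x \<in> F. x \<bullet> u (Suc k) < h}) ` Cm"
        "CC' = (\<lambda>C. proj_along (u (Suc k)) h v' -` C \<inter> {x \<in> F. x \<bullet> u (Suc k) > h}) ` Cp' \<union>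
        (\<lambda>C. proj_along (u (Suc k)) h v' -` C \<inter> {x \<in> F. x \<bullet> u (Suc k) < h}) ` Cm'"
      by (rule yao_frame_step_coupled[OF u M F k2 Suc.prems(3) cp eq fr])
    note dp = bspec[OF dp] and dm = bspec[OF dm]
    note IHp = Suc.IH[OF H[simplified] k1 c(1,2)[simplified] _ fr'(1,3)[simplified]]
      and IHm = Suc.IH[OF H[simplified] k1 c(3,4)[simplified] _ fr'(2,4)[simplified]]
    show ?thesis
    proof (cases e rule: lex_pos_cases[where u = u])
      case 1
      have "lex_pos u j (g' x - g x)" if x: "x \<in> \<Omega>p" for x
      proof -
        obtain t where t: "t > 0" "g' x - g x = f' x - f x + t *\<^sub>R (- e)" using dp[OF x] by blast
        have "x \<in> \<Omega>" "\<forall>i\<in>{2..DIM('a)}. (t *\<^sub>R (- e)) \<bullet> u i = 0" using x sub 1 by auto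
        then show ?thesis unfolding t(2) by (rule lex_pos_add_null[OF pos])
      qed
      then show ?thesis by (rule IHp)
    next
      case (2 i)
      \<comment> \<open>Two positive vectors cannot cancel, and \<open>max j i\<close> is again one
        leading index for all points of the half, as the induction hypothesis demands.\<close>
      have "lex_pos u (max j i) (g' x - g x)" if x: "x \<in> \<Omega>m" for x
      proof -
        obtain t where t: "t > 0" "g' x - g x = f' x - f x + t *\<^sub>R e" using dm[OF x] by blast
        have "x \<in> \<Omega>" using x sub by auto
        then show ?thesis unfolding t(2) by (rule lex_pos_add[OF pos lex_pos_scale[OF 2 t(1)]])
      qed
      then show ?thesis by (rule IHm)
    next
      case (3 i)
      have "lex_pos u (max j i) (g' x - g x)" if x: "x \<in> \<Omega>p" for x
      proof -
        obtain t where t: "t > 0" "g' x - g x = f' x - f x + t *\<^sub>R (- e)" using dp[OF x] by blast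
        have "x \<in> \<Omega>" using x sub by auto
        then show ?thesis unfolding t(2) by (rule lex_pos_add[OF pos lex_pos_scale[OF 3 t(1)]])
      qed
      then show ?thesis by (rule IHp)
    qed
  qed
qed

text \<open>The maps may differ along \<open>u 1\<close> because the normalised projection vectors
  are determined only up to multiples of \<open>u 1\<close>, and the induction must tolerate such a
  difference. Any other component of \<open>e\<close> is excluded by
  \<open>yao_frame_center_mono\<close>: one half would place \<open>c'\<close> strictly after
  \<open>c\<close>, the other strictly before.\<close>

lemma yao_frame_unique_coupled:
  fixes u :: "nat \<Rightarrow> 'a::euclidean_space"
  assumes u: "orthonormal_basis u" and M: "admissible u M"
  shows "flat u k F \<Longrightarrow> 1 \<le> k \<Longrightarrow> k \<le> DIM('a) \<Longrightarrow> flat_cover u k F \<Omega> f \<Longrightarrow> flat_cover u k F \<Omega> f' \<Longrightarrow>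
    (\<And>x i. x \<in> \<Omega> \<Longrightarrow> i \<in> {2..DIM('a)} \<Longrightarrow> (f' x - f x) \<bullet> u i = 0) \<Longrightarrow>
    yao_frame u k F (distr (restr M \<Omega>) borel f) c CC \<Longrightarrow>
    yao_frame u k F (distr (restr M \<Omega>) borel f') c' CC' \<Longrightarrow> CC = CC'"
proof (induction k arbitrary: F \<Omega> f f' CC CC')
  case 0
  then show ?case by simp
next
  case (Suc k)
  note F = Suc.prems(1) and cp = Suc.prems(4,5) and null = Suc.prems(6) and fr = Suc.prems(7,8)
  show ?case
  proof (cases "k = 0")
    case True
    then show ?thesis using fr yao_frame_line[of u F] by (metis One_nat_def)
  next
    case False
    then have k2: "2 \<le> Suc k" and k1: "1 \<le> k" "k \<le> DIM('a)" using Suc.prems(3) by auto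
    have eq: "f' x \<bullet> u (Suc k) = f x \<bullet> u (Suc k)" if "x \<in> \<Omega>" for x
      using null[OF that, of "Suc k"] k2 Suc.prems(3) by (auto simp: inner_diff_left)
    obtain H \<Omega>p g g' \<Omega>m Cp Cm Cp' Cm' e h v' v where
      H: "flat u (Suc k - 1) H" and
      c: "flat_cover u (Suc k - 1) H \<Omega>p g" "flat_cover u (Suc k - 1) H \<Omega>p g'"
        "flat_cover u (Suc k - 1) H \<Omega>m g" "flat_cover u (Suc k - 1) H \<Omega>m g'" and
      fr': "yao_frame u (Suc k - 1) H (distr (restr M \<Omega>p) borel g) c Cp"
        "yao_frame u (Suc k - 1) H (distr (restr M \<Omega>m) borel g) c Cm"
        "yao_frame u (Suc k - 1) H (distr (restr M \<Omega>p) borel g') c' Cp'"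
        "yao_frame u (Suc k - 1) H (distr (restr M \<Omega>m) borel g') c' Cm'" and
      sub: "\<Omega>p \<subseteq> \<Omega>" "\<Omega>m \<subseteq> \<Omega>" and
      dp: "\<forall>x\<in>\<Omega>p. \<exists>t>0. g' x - g x = f' x - f x + t *\<^sub>R (- e)" and
      dm: "\<forall>x\<in>\<Omega>m. \<exists>t>0. g' x - g x = f' x - f x + t *\<^sub>R e" and
      pr: "\<forall>x. \<exists>t. proj_along (u (Suc k)) h v' x = proj_along (u (Suc k)) h v x + t *\<^sub>R e" and
      CC: "CC = (\<lambda>C. proj_along (u (Suc k)) h v -` C \<inter> {x \<in> F. x \<bullet> u (Suc k) > h}) ` Cp \<union>
        (\<lambda>C. proj_along (u (Suc k)) h v -` C \<inter> {x \<in> F. x \<bullet> u (Suc k) < h}) ` Cm"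
        "CC' = (\<lambda>C. proj_along (u (Suc k)) h v' -` C \<inter> {x \<in> F. x \<bullet> u (Suc k) > h}) ` Cp' \<union>
        (\<lambda>C. proj_along (u (Suc k)) h v' -` C \<inter> {x \<in> F. x \<bullet> u (Suc k) < h}) ` Cm'"
      by (rule yao_frame_step_coupled[OF u M F k2 Suc.prems(3) cp eq fr])
    note dp = bspec[OF dp] and dm = bspec[OF dm]
    note H = H[simplified] and c = c[simplified] and fr' = fr'[simplified]
    have null': "\<forall>i\<in>{2..DIM('a)}. (f' x - f x) \<bullet> u i = 0"
      "\<forall>i\<in>{2..DIM('a)}. (- (f' x - f x)) \<bullet> u i = 0" if "x \<in> \<Omega>" for x
      using null[OF that] by (auto simp del: minus_diff_eq)
    \<comment> \<open>A shift in a direction other than \<open>u 1\<close> moves the centers of the two halves apart.\<close>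
    have contra: False
      if i: "lex_pos u i w" and S: "flat_cover u k H \<Omega>1 g" "flat_cover u k H \<Omega>1 g'" "flat_cover u k H \<Omega>2 g"
        "flat_cover u k H \<Omega>2 g'" "\<Omega>1 \<subseteq> \<Omega>" "\<Omega>2 \<subseteq> \<Omega>"
        "yao_frame u k H (distr (restr M \<Omega>1) borel g) c C1" "yao_frame u k H (distr (restr M \<Omega>2) borel g) c C2"
        "yao_frame u k H (distr (restr M \<Omega>1) borel g') c' C1'" "yao_frame u k H (distr (restr M \<Omega>2) borel g') c' C2'"
        and d: "\<And>x. x \<in> \<Omega>1 \<Longrightarrow> \<exists>t>0. g' x - g x = f' x - f x + t *\<^sub>R w"
        "\<And>x. x \<in> \<Omega>2 \<Longrightarrow> \<exists>t>0. g' x - g x = f' x - f x + t *\<^sub>R (- w)"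
      for i w \<Omega>1 \<Omega>2 C1 C2 C1' C2'
    proof -
      have "lex_pos u i (g' x - g x)" if x: "x \<in> \<Omega>1" for x
      proof -
        obtain t where t: "t > 0" "g' x - g x = t *\<^sub>R w + (f' x - f x)" using d(1)[OF x]
          by (auto simp: add.commute)
        show ?thesis unfolding t(2) using x S(5)
          by (intro lex_pos_add_null lex_pos_scale[OF i t(1)] null'(1)) auto
      qed
      then have "\<exists>i. lex_pos u i (c' - c)"
        by (rule yao_frame_center_mono[OF u M H k1 S(1,2) _ S(7,9)])
      moreover have "lex_pos u i (g x - g' x)" if x: "x \<in> \<Omega>2" for x
      proof -
        obtain t where t: "t > 0" "g' x - g x = f' x - f x + t *\<^sub>R (- w)" using d(2)[OF x] by blast
        then have t2: "g x - g' x = t *\<^sub>R w + (- (f' x - f x))" by (simp add: algebra_simps)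
        show ?thesis unfolding t2 using x S(6)
          by (intro lex_pos_add_null lex_pos_scale[OF i t(1)] null'(2)) auto
      qed
      then have "\<exists>i. lex_pos u i (c - c')"
        by (rule yao_frame_center_mono[OF u M H k1 S(4,3) _ S(10,8)])
      ultimately show False using lex_pos_antisym by (metis minus_diff_eq)
    qed
    have e0: "\<forall>i\<in>{2..DIM('a)}. e \<bullet> u i = 0"
    proof (cases e rule: lex_pos_cases[where u = u])
      case 1
      then show ?thesis .
    next
      case (2 i)
      \<comment> \<open>For positive \<open>e\<close> the lower half is the one displaced in the
        positive direction, so the halves trade places.\<close>
      from contra[OF 2 c(3,4,1,2) sub(2,1) fr'(2,1,4,3) dm dp] show ?thesis by blast
    next
      case (3 i)
      from contra[OF 3 c sub fr' dp] dm show ?thesis by simp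
    qed
    have e1: "e = (e \<bullet> u 1) *\<^sub>R u 1"
    proof (rule orthonormal_eqI[OF u])
      fix j assume j: "j \<in> {1..DIM('a)}"
      show "e \<bullet> u j = ((e \<bullet> u 1) *\<^sub>R u 1) \<bullet> u j"
        using e0 j orthonormal_inner[OF u, of 1 j] by (cases "j = 1") auto
    qed
    have "Cp = Cp'"
    proof (rule Suc.IH[OF H k1 c(1,2) _ fr'(1,3)])
      fix x i assume x: "x \<in> \<Omega>p" and i: "i \<in> {2..DIM('a)}"
      obtain t where t: "g' x - g x = f' x - f x + t *\<^sub>R (- e)" using dp[OF x] by blast
      have "x \<in> \<Omega>" using x sub by auto
      then show "(g' x - g x) \<bullet> u i = 0" unfolding t inner_add_left using null[of x i] e0 i by simp
    qed
    moreover have "Cm = Cm'"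
    proof (rule Suc.IH[OF H k1 c(3,4) _ fr'(2,4)])
      fix x i assume x: "x \<in> \<Omega>m" and i: "i \<in> {2..DIM('a)}"
      obtain t where t: "g' x - g x = f' x - f x + t *\<^sub>R e" using dm[OF x] by blast
      have "x \<in> \<Omega>" using x sub by auto
      then show "(g' x - g x) \<bullet> u i = 0" unfolding t inner_add_left using null[of x i] e0 i by simp
    qed
    \<comment> \<open>The two projections of a point differ by a multiple of \<open>u 1\<close>, and
      a set made of lines in that direction cannot tell them apart.\<close>
    moreover have lift: "proj_along (u (Suc k)) h v -` C = proj_along (u (Suc k)) h v' -` C"
      if C: "\<And>x s. x \<in> C \<Longrightarrow> x + s *\<^sub>R u 1 \<in> C" for C
    proof -
      have "proj_along (u (Suc k)) h v x \<in> C \<longleftrightarrow> proj_along (u (Suc k)) h v' x \<in> C" for x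
      proof -
        obtain t where "proj_along (u (Suc k)) h v' x = proj_along (u (Suc k)) h v x + t *\<^sub>R e"
          using pr by blast
        then have t: "proj_along (u (Suc k)) h v' x = proj_along (u (Suc k)) h v x + (t * (e \<bullet> u 1)) *\<^sub>R u 1"
          using e1 by (metis scaleR_scaleR)
        then have "proj_along (u (Suc k)) h v x = proj_along (u (Suc k)) h v' x + (- (t * (e \<bullet> u 1))) *\<^sub>R u 1"
          by simp
        then show ?thesis using t C by metis
      qed
      then show ?thesis by auto
    qed
    moreover have "\<And>C x s. C \<in> Cp \<Longrightarrow> x \<in> C \<Longrightarrow> x + s *\<^sub>R u 1 \<in> C"
      "\<And>C x s. C \<in> Cm \<Longrightarrow> x \<in> C \<Longrightarrow> x + s *\<^sub>R u 1 \<in> C"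
      using yao_frame_invariant[OF fr'(1) u H k1(2)] yao_frame_invariant[OF fr'(2) u H k1(2)] by blast+
    ultimately show ?thesis unfolding CC
      by (intro arg_cong2[where f = "(\<union>)"] image_cong arg_cong2[where f = "(\<inter>)"]) auto
  qed
qed

text \<open>The coupling starts from the identity on the whole space, with zero displacement. Only
  the cells are compared, since the centers may differ along \<open>u 1\<close>.\<close>

lemma yao_frame_unique:
  fixes u :: "nat \<Rightarrow> 'a::euclidean_space"
  assumes u: "orthonormal_basis u" and M: "admissible u M"
    and fr: "yao_frame u DIM('a) UNIV M c CC" "yao_frame u DIM('a) UNIV M c' CC'"
  shows "CC = CC'"
proof -
  have sets: "sets M = sets borel" using M by (simp add: admissible_def)
  have "distr (restr M UNIV) borel (\<lambda>x. x) = M"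
  proof (rule measure_eqI)
    fix X assume "X \<in> sets (distr (restr M UNIV) borel (\<lambda>x. x))"
    then show "emeasure (distr (restr M UNIV) borel (\<lambda>x. x)) X = emeasure M X"
      using emeasure_distr_restr[of UNIV M X "\<lambda>x. x"] sets by (simp cong: measurable_cong_sets)
  qed (simp add: sets)
  moreover have "flat_cover u DIM('a) UNIV UNIV (\<lambda>x. x)" by (simp add: flat_cover_def)
  ultimately show ?thesis
    using yao_frame_unique_coupled[OF u M flat_UNIV, of UNIV "\<lambda>x. x" "\<lambda>x. x" c CC c' CC'] fr
    by (simp add: Suc_leI)
qed

section \<open>Multicenter partitions\<close>

lemma ab_partition_regions:
  fixes u :: "nat \<Rightarrow> 'a::euclidean_space"
  assumes u: "orthonormal_basis u" and M: "admissible u M"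
    and R: "ab_partition \<alpha> \<beta> u DIM('a) UNIV M c R" and "\<alpha> > 0" "\<beta> > 0" "\<alpha> + \<beta> = 1"
    and AB: "(A, B) \<in> R"
  shows "A \<in> sets borel" "B \<in> sets borel" "measure M A > 0" "measure M B = \<beta> * measure M UNIV / 2 ^ (DIM('a) - 1)"
    "measure M B > 0" "measure M (A \<inter> B) = 0" "measure M (A \<union> B) = measure M UNIV / 2 ^ (DIM('a) - 1)"
proof -
  have fin: "finite_measure M" and sets: "sets M = sets borel" using M by (auto simp: admissible_def)
  interpret finite_measure M by fact
  have "measure M UNIV > 0" using M unfolding admissible_def by blast
  moreover have *: "A \<in> sets borel" "B \<in> sets borel"
    "measure M A = \<alpha> * measure M UNIV / 2 ^ (DIM('a) - 1)"
    "measure M B = \<beta> * measure M UNIV / 2 ^ (DIM('a) - 1)" "measure M (A \<inter> B) = 0"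
    using ab_partition_measure[OF R u flat_UNIV order_refl fin sets assms(6)] AB by auto
  ultimately show "A \<in> sets borel" "B \<in> sets borel" "measure M A > 0" "measure M B > 0"
    "measure M (A \<inter> B) = 0" "measure M B = \<beta> * measure M UNIV / 2 ^ (DIM('a) - 1)"
    using assms by auto
  have "measure M (A \<union> B) = measure M A + measure M B - measure M (A \<inter> B)"
    using * sets measure_Un3[of A M B] by (simp add: fmeasurable_eq_sets)
  also have "\<dots> = (\<alpha> + \<beta>) * measure M UNIV / 2 ^ (DIM('a) - 1)"
    unfolding * by (simp add: distrib_right add_divide_distrib)
  finally show "measure M (A \<union> B) = measure M UNIV / 2 ^ (DIM('a) - 1)" using assms(6) by simp
qed

text \<open>By disjointness of the cells, a region inside one cell meets the union of all
  \<open>B\<close> parts only in its own. New regions can thus be written without mention of their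
  cell.\<close>

lemma ab_partition_Int_Union_snd:
  fixes u :: "nat \<Rightarrow> 'a::euclidean_space"
  assumes u: "orthonormal_basis u" and R: "ab_partition \<alpha> \<beta> u DIM('a) UNIV M c R"
    and AB: "(A, B) \<in> R" and X: "X \<subseteq> A \<union> B"
  shows "X \<inter> \<Union> (snd ` R) = X \<inter> B"
proof -
  have "X \<inter> B' \<subseteq> B" if "(A', B') \<in> R" for A' B'
  proof -
    have "A = A' \<and> B = B' \<or> (A \<union> B) \<inter> (A' \<union> B') = {}"
      using ab_partition_disjoint[OF R u flat_UNIV order_refl] AB that by fast
    then show ?thesis using X by auto
  qed
  then show ?thesis using AB by force
qed

text \<open>An open set closed under translation along \<open>u 1\<close> has positive measure, so
  it meets some cell, and the ray from a common point enters \<open>B1\<close> without leaving the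
  set. As \<open>B1\<close> is convex with nonempty interior, that interior is dense in it and meets
  the open set too. The intersection is open and again closed under translation, so the positivity
  of \<open>M\<close> applies to it.\<close>

lemma admissible_restr_Union_snd:
  fixes u :: "nat \<Rightarrow> 'a::euclidean_space"
  assumes u: "orthonormal_basis u" and M: "admissible u M"
    and R: "ab_partition \<alpha> \<beta> u DIM('a) UNIV M c R" and ab: "\<alpha> > 0" "\<beta> > 0" "\<alpha> + \<beta> = 1"
  shows "\<Union> (snd ` R) \<in> sets borel" "admissible u (restr M (\<Union> (snd ` R)))"
proof -
  let ?B = "\<Union> (snd ` R)"
  have fin: "finite_measure M" and sets: "sets M = sets borel" and ac: "absolutely_continuous lborel M"
    and pos: "\<And>A. open A \<Longrightarrow> A \<noteq> {} \<Longrightarrow> (\<forall>x\<in>A. \<forall>s\<ge>0. x + s *\<^sub>R u 1 \<in> A) \<Longrightarrow> measure M A > 0"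
    using M by (auto simp: admissible_def)
  interpret finite_measure M by fact
  note reg = ab_partition_regions[OF u M R ab]
  show B: "?B \<in> sets borel"
    using ab_partition_finite[OF R u flat_UNIV order_refl] reg(2) by (intro sets.finite_Union) auto
  have "absolutely_continuous lborel (restr M ?B)"
    unfolding absolutely_continuous_def
  proof
    fix X :: "'a set" assume X: "X \<in> null_sets lborel"
    then have X': "X \<in> null_sets M" using ac by (auto simp: absolutely_continuous_def)
    then have "emeasure M (?B \<inter> X) = 0" using B sets
      by (metis emeasure_eq_0 inf_le2 null_setsD1 null_setsD2)
    then show "X \<in> null_sets (restr M ?B)"
      using X' B sets by (auto simp: null_sets_def emeasure_restr)
  qed
  moreover have "measure (restr M ?B) A > 0"
    if A: "open A" "A \<noteq> {}" "\<forall>x\<in>A. \<forall>s\<ge>0. x + s *\<^sub>R u 1 \<in> A" for A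
  proof -
    let ?U = "\<Union>(A, B)\<in>R. A \<union> B"
    have "?U \<in> sets M" using ab_partition_finite[OF R u flat_UNIV order_refl] reg(1,2) sets
      by (intro sets.finite_UN) auto
    moreover have "measure M (UNIV - ?U) = 0"
      using ab_partition_measure[OF R u flat_UNIV order_refl fin sets ab(3)] by blast
    ultimately have "\<not> A \<subseteq> UNIV - ?U"
      using finite_measure_mono[of A "UNIV - ?U"] pos[OF A] sets by auto
    then obtain x A1 B1 where x: "x \<in> A" "(A1, B1) \<in> R" "x \<in> A1 \<union> B1" by blast
    have ray: "\<forall>x\<in>B1. \<forall>s\<ge>0. x + s *\<^sub>R u 1 \<in> B1" "\<forall>x\<in>A1. \<exists>s\<ge>0. x + s *\<^sub>R u 1 \<in> B1"
      using ab_partition_ray[OF R u flat_UNIV order_refl] x(2) by auto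
    have cvx: "convex B1"
      using ab_partition_convex_borel[OF R u flat_UNIV order_refl] x(2) by auto
    have "x \<in> A1 \<or> x \<in> B1" using x(3) by simp
    then obtain s where s: "s \<ge> 0" "x + s *\<^sub>R u 1 \<in> B1"
    proof
      assume "x \<in> B1"
      then show thesis using that[of 0] by simp
    next
      assume "x \<in> A1"
      then show thesis using that ray(2) by blast
    qed
    \<comment> \<open>A convex set without interior points is a Lebesgue null set, but
      \<open>B1\<close> has positive measure.\<close>
    have "interior B1 \<noteq> {}"
    proof
      assume "interior B1 = {}"
      then have "negligible B1" using negligible_convex_interior[OF cvx] by simp
      then have "B1 \<in> null_sets lborel"
        using reg(2)[OF x(2)] by (simp add: negligible_iff_null_sets null_sets_completion_iff)
      then have "B1 \<in> null_sets M" using ac by (auto simp: absolutely_continuous_def)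
      then have "measure M B1 = 0" by (simp add: measure_def null_setsD1)
      then show False using reg(5)[OF x(2)] by simp
    qed
    then have "closure (interior B1) = closure B1" using convex_closure_interior[OF cvx] by simp
    moreover have "x + s *\<^sub>R u 1 \<in> A \<inter> closure B1"
      using A(3) x(1) s closure_subset[of B1] by auto
    ultimately have ne: "A \<inter> interior B1 \<noteq> {}" using open_Int_closure_eq_empty[OF A(1)] by blast
    have "y + s *\<^sub>R u 1 \<in> interior B1" if y: "y \<in> interior B1" "s \<ge> 0" for y s
    proof (rule interiorI)
      show "open ((+) (s *\<^sub>R u 1) ` interior B1)" by (intro open_translation) simp
      show "y + s *\<^sub>R u 1 \<in> (+) (s *\<^sub>R u 1) ` interior B1" using y by (auto simp: add.commute)
      have "s *\<^sub>R u 1 + z \<in> B1" if "z \<in> interior B1" for z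
        using ray(1) that y(2) interior_subset[of B1] by (metis add.commute subsetD)
      then show "(+) (s *\<^sub>R u 1) ` interior B1 \<subseteq> B1" by blast
    qed
    then have "measure M (A \<inter> interior B1) > 0"
      using A ne by (intro pos) auto
    also have "measure M (A \<inter> interior B1) \<le> measure M (?B \<inter> A)"
    proof (rule finite_measure_mono)
      have "interior B1 \<subseteq> ?B" using interior_subset[of B1] x(2) by force
      then show "A \<inter> interior B1 \<subseteq> ?B \<inter> A" by blast
      show "?B \<inter> A \<in> sets M" using B A(1) sets by auto
    qed
    also have "\<dots> = measure (restr M ?B) A" using B A(1) sets by (simp add: measure_restr)
    finally show ?thesis .
  qed
  ultimately show "admissible u (restr M ?B)"
    using finite_measure_restr[OF fin] B sets by (auto simp: admissible_def)
qed

lemma ab_partition_yao_frame: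
  fixes u :: "nat \<Rightarrow> 'a::euclidean_space"
  assumes u: "orthonormal_basis u" and M: "admissible u M"
    and R: "ab_partition \<alpha> \<beta> u DIM('a) UNIV M c R" and ab: "\<alpha> > 0" "\<beta> > 0" "\<alpha> + \<beta> = 1"
  shows "yao_frame u DIM('a) UNIV M c ((\<lambda>(A, B). A \<union> B) ` R)"
    "yao_frame u DIM('a) UNIV (restr M (\<Union> (snd ` R))) c ((\<lambda>(A, B). A \<union> B) ` R)"
proof -
  let ?B = "\<Union> (snd ` R)" and ?U = "\<Union>(A, B)\<in>R. A \<union> B"
  have fin: "finite_measure M" and sets: "sets M = sets borel" using M by (auto simp: admissible_def)
  interpret finite_measure M by fact
  note reg = ab_partition_regions[OF u M R ab]
  have B: "?B \<in> sets M" using admissible_restr_Union_snd(1)[OF u M R ab] sets by simp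
  have U: "?U \<in> sets M" using ab_partition_finite[OF R u flat_UNIV order_refl] reg(1,2) sets
    by (intro sets.finite_UN) auto
  have U0: "measure M (UNIV - ?U) = 0"
    using ab_partition_measure[OF R u flat_UNIV order_refl fin sets ab(3)] by blast
  have "\<forall>(A, B)\<in>R. measure M (A \<union> B) = measure M UNIV / 2 ^ (DIM('a) - 1)" using reg(7) by blast
  then show "yao_frame u DIM('a) UNIV M c ((\<lambda>(A, B). A \<union> B) ` R)"
    using yao_frame_of_ab_partition[OF R u flat_UNIV order_refl fin sets _ U0] by blast
  have m: "\<forall>(A, B)\<in>R. measure (restr M ?B) (A \<union> B) = \<beta> * measure M UNIV / 2 ^ (DIM('a) - 1)"
  proof (intro ballI, unfold split_paired_all prod.case)
    fix A1 B1 assume AB: "(A1, B1) \<in> R"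
    have "measure (restr M ?B) (A1 \<union> B1) = measure M (?B \<inter> (A1 \<union> B1))"
      using reg(1,2)[OF AB] sets B by (intro measure_restr) auto
    also have "?B \<inter> (A1 \<union> B1) = (A1 \<union> B1) \<inter> B1"
      using ab_partition_Int_Union_snd[OF u R AB order_refl] by (simp add: Int_commute)
    also have "\<dots> = B1" by auto
    finally show "measure (restr M ?B) (A1 \<union> B1) = \<beta> * measure M UNIV / 2 ^ (DIM('a) - 1)"
      using reg(4)[OF AB] by simp
  qed
  have "measure (restr M ?B) (UNIV - ?U) = 0"
  proof -
    have D: "UNIV - ?U \<in> sets M" using U sets by auto
    have "measure (restr M ?B) (UNIV - ?U) \<le> measure M (UNIV - ?U)"
      unfolding measure_restr[OF B D] by (intro finite_measure_mono) (use D in auto)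
    then show ?thesis using U0 by (simp add: measure_le_0_iff)
  qed
  then show "yao_frame u DIM('a) UNIV (restr M ?B) c ((\<lambda>(A, B). A \<union> B) ` R)"
    using yao_frame_of_ab_partition[OF R u flat_UNIV order_refl finite_measure_restr[OF fin B] _ m] sets
    by simp
qed

section \<open>Hyperplanes and the count of regions\<close>

lemma interior_misses_hyperplane:
  fixes a :: "'a::euclidean_space"
  assumes "a \<noteq> 0" "\<forall>x\<in>K. a \<bullet> x \<le> b"
  shows "{x. a \<bullet> x = b} \<inter> interior K = {}"
proof -
  have "interior K \<subseteq> interior {x. a \<bullet> x \<le> b}" using assms(2) by (intro interior_mono) auto
  then show ?thesis using interior_halfspace_le[OF assms(1), of b] by auto
qed

lemma ab_partition_hyperplane:
  fixes u :: "nat \<Rightarrow> 'a::euclidean_space"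
  assumes u: "orthonormal_basis u" and R: "ab_partition \<alpha> \<beta> u DIM('a) UNIV M c R"
    and G: "is_hyperplane G"
  shows "(\<exists>(A, B)\<in>R. G \<inter> interior A = {}) \<or> (\<exists>(A, B)\<in>R. G \<inter> interior B = {})"
proof -
  obtain a b where a: "a \<noteq> 0" "G = {x. a \<bullet> x = b}" "0 \<le> a \<bullet> u 1"
  proof -
    obtain a b where ab: "a \<noteq> 0" "G = {x. a \<bullet> x = b}" using G by (auto simp: is_hyperplane_def)
    show thesis
    proof (cases "0 \<le> a \<bullet> u 1")
      case False
      then show thesis using that[of "- a" "- b"] ab by auto
    qed (use that ab in blast)
  qed
  obtain A B A' B' where AB: "(A, B) \<in> R" "\<forall>x\<in>A. a \<bullet> x \<le> a \<bullet> c"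
    "(A', B') \<in> R" "\<forall>x\<in>B'. a \<bullet> c \<le> a \<bullet> x"
    using ab_partition_halfspaces[OF R u flat_UNIV order_refl a(3)] by blast
  show ?thesis
  proof (cases "a \<bullet> c \<le> b")
    case True
    then have "G \<inter> interior A = {}"
      unfolding a(2) using AB(2) a(1) by (intro interior_misses_hyperplane) auto
    then show ?thesis using AB(1) by blast
  next
    case False
    then have "\<forall>x\<in>B'. (- a) \<bullet> x \<le> - b" using AB(4) by auto
    then have "{x. (- a) \<bullet> x = - b} \<inter> interior B' = {}"
      using a(1) by (intro interior_misses_hyperplane) auto
    then have "G \<inter> interior B' = {}" unfolding a(2) by simp
    then show ?thesis using AB(3) by blast
  qed
qed

text \<open>Null overlaps take the place of disjointness because \<open>A\<close> and
  \<open>B\<close> of a pair may share what is lifted from the center. Together with positive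
  measure they keep members from coinciding as sets, so that cardinalities count regions.\<close>

definition refines_frame :: "'a measure \<Rightarrow> nat \<Rightarrow> 'a set set \<Rightarrow> 'a set set \<Rightarrow> bool" where
  "refines_frame M n CC P \<longleftrightarrow> finite P \<and> (\<forall>K\<in>P. K \<in> sets M \<and> measure M K > 0) \<and>
     (\<forall>K\<in>P. \<forall>K'\<in>P. K \<noteq> K' \<longrightarrow> measure M (K \<inter> K') = 0) \<and>
     (\<forall>K\<in>P. \<exists>C\<in>CC. K \<subseteq> C) \<and> (\<forall>C\<in>CC. n \<le> card {K \<in> P. K \<subseteq> C})"

lemma refines_frame_finite: "refines_frame M n CC P \<Longrightarrow> finite P"
  by (simp add: refines_frame_def)

lemma refines_frame_card: "refines_frame M n CC P \<Longrightarrow> C \<in> CC \<Longrightarrow> n \<le> card {K \<in> P. K \<subseteq> C}"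
  by (simp add: refines_frame_def)

lemma yao_yao_refines_frame:
  fixes u :: "nat \<Rightarrow> 'a::euclidean_space"
  assumes u: "orthonormal_basis u" and M: "admissible u M"
    and R: "ab_partition \<alpha> \<beta> u DIM('a) UNIV M c R" and ab: "\<alpha> > 0" "\<beta> > 0" "\<alpha> + \<beta> = 1"
  shows "refines_frame M 2 ((\<lambda>(A, B). A \<union> B) ` R) (fst ` R \<union> snd ` R)"
proof -
  have sets: "sets M = sets borel" using M by (auto simp: admissible_def)
  note reg = ab_partition_regions[OF u M R ab]
  have finR: "finite R" using ab_partition_finite[OF R u flat_UNIV order_refl] .
  let ?P = "fst ` R \<union> snd ` R"
  have mem: "\<exists>A B. (A, B) \<in> R \<and> (K = A \<or> K = B)" if "K \<in> ?P" for K using that by force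
  have "measure M (K \<inter> K') = 0" if KK: "K \<in> ?P" "K' \<in> ?P" "K \<noteq> K'" for K K'
  proof -
    obtain A B A' B' where K: "(A, B) \<in> R" "K = A \<or> K = B" "(A', B') \<in> R" "K' = A' \<or> K' = B'"
      using mem[OF KK(1)] mem[OF KK(2)] by blast
    have "A = A' \<and> B = B' \<or> (A \<union> B) \<inter> (A' \<union> B') = {}"
      using ab_partition_disjoint[OF R u flat_UNIV order_refl] K(1,3) by fast
    then show ?thesis
    proof
      assume "A = A' \<and> B = B'"
      then show ?thesis using K KK(3) reg(6)[OF K(1)] by (auto simp: Int_commute)
    next
      assume "(A \<union> B) \<inter> (A' \<union> B') = {}"
      then have "K \<inter> K' = {}" using K by blast
      then show ?thesis by simp
    qed
  qed
  moreover have "2 \<le> card {K \<in> ?P. K \<subseteq> A \<union> B}" if AB: "(A, B) \<in> R" for A B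
  proof -
    \<comment> \<open>If they were equal, the null set \<open>A \<inter> B\<close> would have
      positive measure.\<close>
    have "A \<noteq> B" using reg(3,6)[OF AB] by auto
    then have "2 = card {A, B}" by simp
    also have "\<dots> \<le> card {K \<in> ?P. K \<subseteq> A \<union> B}"
      using AB finR by (intro card_mono) force+
    finally show ?thesis .
  qed
  moreover have "K \<in> sets M \<and> measure M K > 0" if "K \<in> ?P" for K
    using mem[OF that] reg(1-3,5) sets by blast
  moreover have "\<exists>C\<in>(\<lambda>(A, B). A \<union> B) ` R. K \<subseteq> C" if "K \<in> ?P" for K
    using mem[OF that] by force
  ultimately show ?thesis using finR unfolding refines_frame_def by auto
qed

text \<open>Replaces the comprehension of the construction by the traces of \<open>P\<close> on the
  union of the \<open>B\<close> parts. Distinct members keep distinct traces: equal traces would be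
  an overlap of positive measure.\<close>

lemma add_center_regions:
  fixes u :: "nat \<Rightarrow> 'a::euclidean_space"
  assumes u: "orthonormal_basis u" and M: "admissible u M"
    and R: "ab_partition \<alpha> \<beta> u DIM('a) UNIV M c R" and ab: "\<alpha> > 0" "\<beta> > 0" "\<alpha> + \<beta> = 1"
    and P: "refines_frame (restr M (\<Union> (snd ` R))) n ((\<lambda>(A, B). A \<union> B) ` R) P"
  shows "{K \<inter> Bi | K Ai Bi. (Ai, Bi) \<in> R \<and> K \<subseteq> Ai \<union> Bi \<and> K \<in> P} = (\<lambda>K. K \<inter> \<Union> (snd ` R)) ` P"
    "inj_on (\<lambda>K. K \<inter> \<Union> (snd ` R)) P"
    "\<And>K. K \<in> P \<Longrightarrow> K \<inter> \<Union> (snd ` R) \<in> sets borel \<and> measure M (K \<inter> \<Union> (snd ` R)) > 0"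
    "\<And>K K'. K \<in> P \<Longrightarrow> K' \<in> P \<Longrightarrow> K \<noteq> K' \<Longrightarrow> measure M (K \<inter> \<Union> (snd ` R) \<inter> (K' \<inter> \<Union> (snd ` R))) = 0"
    "\<And>K A B. K \<in> P \<Longrightarrow> (A, B) \<in> R \<Longrightarrow> measure M (A \<inter> (K \<inter> \<Union> (snd ` R))) = 0"
proof -
  let ?B = "\<Union> (snd ` R)"
  have fin: "finite_measure M" and sets: "sets M = sets borel" using M by (auto simp: admissible_def)
  interpret finite_measure M by fact
  note reg = ab_partition_regions[OF u M R ab]
  have B: "?B \<in> sets M" using admissible_restr_Union_snd(1)[OF u M R ab] sets by simp
  have Pm: "K \<in> sets M" "measure (restr M ?B) K > 0" if "K \<in> P" for K
    using P that by (auto simp: refines_frame_def)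
  have Pd: "measure (restr M ?B) (K \<inter> K') = 0" if "K \<in> P" "K' \<in> P" "K \<noteq> K'" for K K'
    using P that by (auto simp: refines_frame_def)
  have Pc: "\<exists>A B. (A, B) \<in> R \<and> K \<subseteq> A \<union> B" if "K \<in> P" for K
    using P that unfolding refines_frame_def by fast
  show "{K \<inter> Bi | K Ai Bi. (Ai, Bi) \<in> R \<and> K \<subseteq> Ai \<union> Bi \<and> K \<in> P} = (\<lambda>K. K \<inter> ?B) ` P"
  proof
    show "{K \<inter> Bi | K Ai Bi. (Ai, Bi) \<in> R \<and> K \<subseteq> Ai \<union> Bi \<and> K \<in> P} \<subseteq> (\<lambda>K. K \<inter> ?B) ` P"
    proof
      fix X assume "X \<in> {K \<inter> Bi | K Ai Bi. (Ai, Bi) \<in> R \<and> K \<subseteq> Ai \<union> Bi \<and> K \<in> P}"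
      then obtain K A1 B1 where K: "X = K \<inter> B1" "(A1, B1) \<in> R" "K \<subseteq> A1 \<union> B1" "K \<in> P" by blast
      then have "X = K \<inter> ?B" using ab_partition_Int_Union_snd[OF u R K(2,3)] by simp
      then show "X \<in> (\<lambda>K. K \<inter> ?B) ` P" using K(4) by blast
    qed
    show "(\<lambda>K. K \<inter> ?B) ` P \<subseteq> {K \<inter> Bi | K Ai Bi. (Ai, Bi) \<in> R \<and> K \<subseteq> Ai \<union> Bi \<and> K \<in> P}"
    proof
      fix X assume "X \<in> (\<lambda>K. K \<inter> ?B) ` P"
      then obtain K where K: "K \<in> P" "X = K \<inter> ?B" by blast
      obtain A1 B1 where AB: "(A1, B1) \<in> R" "K \<subseteq> A1 \<union> B1" using Pc[OF K(1)] by blast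
      have "X = K \<inter> B1" using K(2) ab_partition_Int_Union_snd[OF u R AB] by simp
      then show "X \<in> {K \<inter> Bi | K Ai Bi. (Ai, Bi) \<in> R \<and> K \<subseteq> Ai \<union> Bi \<and> K \<in> P}"
        using K(1) AB by blast
    qed
  qed
  show pos: "K \<inter> ?B \<in> sets borel \<and> measure M (K \<inter> ?B) > 0" if "K \<in> P" for K
    using Pm[OF that] measure_restr[OF B Pm(1)[OF that]] B sets by (simp add: Int_commute)
  show null: "measure M (K \<inter> ?B \<inter> (K' \<inter> ?B)) = 0" if "K \<in> P" "K' \<in> P" "K \<noteq> K'" for K K'
  proof -
    have "K \<inter> ?B \<inter> (K' \<inter> ?B) = ?B \<inter> (K \<inter> K')" by blast
    then show ?thesis
      using Pd[OF that] measure_restr[OF B, of "K \<inter> K'"] Pm(1) that by simp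
  qed
  show "inj_on (\<lambda>K. K \<inter> ?B) P"
  proof (rule inj_onI, rule ccontr)
    fix K K' assume K: "K \<in> P" "K' \<in> P" "K \<inter> ?B = K' \<inter> ?B" "K \<noteq> K'"
    then show False using null[OF K(1,2,4)] pos[OF K(1)] by simp
  qed
  show "measure M (A \<inter> (K \<inter> ?B)) = 0" if K: "K \<in> P" "(A, B) \<in> R" for K A B
  proof -
    obtain A1 B1 where AB: "(A1, B1) \<in> R" "K \<subseteq> A1 \<union> B1" using Pc[OF K(1)] by blast
    have eq: "K \<inter> ?B = K \<inter> B1" using ab_partition_Int_Union_snd[OF u R AB] .
    have "A = A1 \<and> B = B1 \<or> (A \<union> B) \<inter> (A1 \<union> B1) = {}"
      using ab_partition_disjoint[OF R u flat_UNIV order_refl] K(2) AB(1) by fast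
    then have "A \<inter> (K \<inter> ?B) \<subseteq> A1 \<inter> B1" unfolding eq by blast
    then have "measure M (A \<inter> (K \<inter> ?B)) \<le> measure M (A1 \<inter> B1)"
      using reg(1,2)[OF AB(1)] sets by (intro finite_measure_mono) auto
    then show ?thesis using reg(6)[OF AB(1)] by (simp add: measure_le_0_iff)
  qed
qed

text \<open>Each cell keeps the traces of its regions, still pairwise distinct, and gains its own
  \<open>A\<close>.\<close>

lemma add_center_refines_frame:
  fixes u :: "nat \<Rightarrow> 'a::euclidean_space"
  assumes u: "orthonormal_basis u" and M: "admissible u M"
    and R: "ab_partition \<alpha> \<beta> u DIM('a) UNIV M c R" and ab: "\<alpha> > 0" "\<beta> > 0" "\<alpha> + \<beta> = 1"
    and P: "refines_frame (restr M (\<Union> (snd ` R))) n ((\<lambda>(A, B). A \<union> B) ` R) P"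
  shows "refines_frame M (Suc n) ((\<lambda>(A, B). A \<union> B) ` R)
    (fst ` R \<union> (\<lambda>K. K \<inter> \<Union> (snd ` R)) ` P)"
proof -
  let ?B = "\<Union> (snd ` R)"
  let ?Q = "fst ` R \<union> (\<lambda>K. K \<inter> ?B) ` P"
  have sets: "sets M = sets borel" using M by (auto simp: admissible_def)
  note reg = ab_partition_regions[OF u M R ab] and add = add_center_regions[OF u M R ab P]
  have finR: "finite R" using ab_partition_finite[OF R u flat_UNIV order_refl] .
  have finP: "finite P" using refines_frame_finite[OF P] .
  have A: "K \<in> fst ` R \<Longrightarrow> \<exists>B. (K, B) \<in> R" for K by force
  have "K \<in> sets M \<and> measure M K > 0" if "K \<in> ?Q" for K
    using that reg(1,3) add(3) sets by auto
  moreover have "measure M (K \<inter> K') = 0" if KK: "K \<in> ?Q" "K' \<in> ?Q" "K \<noteq> K'" for K K'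
  proof -
    consider "K \<in> fst ` R" "K' \<in> fst ` R" | L where "K \<in> fst ` R" "L \<in> P" "K' = L \<inter> ?B"
      | L where "K' \<in> fst ` R" "L \<in> P" "K = L \<inter> ?B"
      | L L' where "L \<in> P" "L' \<in> P" "K = L \<inter> ?B" "K' = L' \<inter> ?B"
      using KK(1,2) by blast
    then show ?thesis
    proof cases
      case 1
      obtain B B' where "(K, B) \<in> R" "(K', B') \<in> R" using 1 A by blast
      then have "(K \<union> B) \<inter> (K' \<union> B') = {}"
        using ab_partition_disjoint[OF R u flat_UNIV order_refl] KK(3) by fast
      then have "K \<inter> K' = {}" by blast
      then show ?thesis by simp
    next
      case 2
      then show ?thesis using add(5) A by blast
    next
      case 3
      then show ?thesis using add(5) A by (metis Int_commute)
    next
      case 4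
      then show ?thesis using add(4)[of L L'] KK(3) by blast
    qed
  qed
  moreover have "\<exists>C\<in>(\<lambda>(A, B). A \<union> B) ` R. K \<subseteq> C" if "K \<in> ?Q" for K
  proof -
    have "\<exists>A B. (A, B) \<in> R \<and> L \<subseteq> A \<union> B" if "L \<in> P" for L
      using P that unfolding refines_frame_def by fast
    moreover have "\<exists>A B. (A, B) \<in> R \<and> K \<subseteq> A \<union> B" if "K \<in> fst ` R" for K using A[OF that] by blast
    ultimately have "\<exists>A B. (A, B) \<in> R \<and> K \<subseteq> A \<union> B" using that by blast
    then obtain A B where "(A, B) \<in> R" "K \<subseteq> A \<union> B" by blast
    then show ?thesis by (intro bexI[of _ "A \<union> B"] image_eqI[of _ _ "(A, B)"]) auto
  qed
  moreover have "Suc n \<le> card {K \<in> ?Q. K \<subseteq> A \<union> B}" if AB: "(A, B) \<in> R" for A B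
  proof -
    let ?S = "{K \<in> P. K \<subseteq> A \<union> B}"
    have "A \<union> B \<in> (\<lambda>(A, B). A \<union> B) ` R" using AB by (intro image_eqI[of _ _ "(A, B)"]) auto
    then have "n \<le> card ?S" by (rule refines_frame_card[OF P])
    moreover have "card ((\<lambda>K. K \<inter> ?B) ` ?S) = card ?S"
      by (rule card_image[OF inj_on_subset[OF add(2)]]) blast
    \<comment> \<open>\<open>A\<close> has positive measure but meets every trace in a null set, so
      it raises the count by one.\<close>
    moreover have "A \<notin> (\<lambda>K. K \<inter> ?B) ` ?S"
    proof
      assume "A \<in> (\<lambda>K. K \<inter> ?B) ` ?S"
      then obtain K where "K \<in> P" "A = K \<inter> ?B" by blast
      then show False using add(5)[OF \<open>K \<in> P\<close> AB] reg(3)[OF AB] by simp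
    qed
    ultimately have "Suc n \<le> card (insert A ((\<lambda>K. K \<inter> ?B) ` ?S))"
      using finP by simp
    also have "\<dots> \<le> card {K \<in> ?Q. K \<subseteq> A \<union> B}"
    proof (rule card_mono)
      show "finite {K \<in> ?Q. K \<subseteq> A \<union> B}" using finP finR by simp
      have "A \<in> fst ` R" using AB by (intro image_eqI[of _ _ "(A, B)"]) auto
      moreover have "K \<inter> ?B \<subseteq> A \<union> B" if "K \<in> ?S" for K using that by blast
      ultimately show "insert A ((\<lambda>K. K \<inter> ?B) ` ?S) \<subseteq> {K \<in> ?Q. K \<subseteq> A \<union> B}"
        by (intro insert_subsetI image_subsetI CollectI conjI) simp_all
    qed
    finally show ?thesis .
  qed
  ultimately show ?thesis using finR finP unfolding refines_frame_def by auto
qed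

text \<open>The frame is carried along with the count because a missed \<open>B\<close> part must
  contain many regions, and the number of missed regions of \<open>P\<close> says nothing about how
  \<open>P\<close> is distributed over the cells.\<close>

lemma multicenter_partition_frame_hyperplane:
  fixes u :: "nat \<Rightarrow> 'a::euclidean_space"
  assumes u: "orthonormal_basis u" and G: "is_hyperplane G"
    and "multicenter_partition u t M P" "admissible u M"
  shows "(\<exists>c CC. yao_frame u DIM('a) UNIV M c CC \<and> refines_frame M (Suc t) CC P) \<and>
    t \<le> card {K \<in> P. G \<inter> interior K = {}}"
  using assms(3,4)
proof (induction rule: multicenter_partition.induct)
  case (yao_yao M R)
  obtain c where R: "ab_partition (1/2) (1/2) u DIM('a) UNIV M c R"
    using yao_yao.hyps by (auto simp: is_ab_partition_def)
  have half: "(1/2::real) > 0" "(1/2::real) + 1/2 = 1" by auto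
  note rf = yao_yao_refines_frame[OF u yao_yao.prems R half(1,1,2)]
  have "finite (fst ` R \<union> snd ` R)" using refines_frame_finite[OF rf] .
  moreover have "{K \<in> fst ` R \<union> snd ` R. G \<inter> interior K = {}} \<noteq> {}"
    using ab_partition_hyperplane[OF u R G]
  proof
    assume "\<exists>(A, B)\<in>R. G \<inter> interior A = {}"
    then obtain A B where "(A, B) \<in> R" "G \<inter> interior A = {}" by blast
    moreover from this(1) have "A \<in> fst ` R" by (rule image_eqI[rotated]) simp
    ultimately show ?thesis by blast
  next
    assume "\<exists>(A, B)\<in>R. G \<inter> interior B = {}"
    then obtain A B where "(A, B) \<in> R" "G \<inter> interior B = {}" by blast
    moreover from this(1) have "B \<in> snd ` R" by (rule image_eqI[rotated]) simp
    ultimately show ?thesis by blast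
  qed
  ultimately have "1 \<le> card {K \<in> fst ` R \<union> snd ` R. G \<inter> interior K = {}}"
    by (simp add: Suc_leI card_gt_0_iff)
  moreover have "refines_frame M (Suc 1) ((\<lambda>(A, B). A \<union> B) ` R) (fst ` R \<union> snd ` R)"
    using rf by (simp add: numeral_2_eq_2)
  ultimately show ?case
    using ab_partition_yao_frame(1)[OF u yao_yao.prems R half(1,1,2)] by blast
next
  case (add_center t M R B P)
  obtain c where R: "ab_partition (1 / (real t + 1)) (real t / (real t + 1)) u DIM('a) UNIV M c R"
    and ab: "1 / (real t + 1) > 0" "real t / (real t + 1) > 0"
      "1 / (real t + 1) + real t / (real t + 1) = 1"
    using add_center.hyps(2) unfolding is_ab_partition_def by blast
  note M = add_center.prems
  have adm: "admissible u (restr M B)"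
    unfolding add_center.hyps(3) by (rule admissible_restr_Union_snd(2)[OF u M R ab])
  obtain c' CC where CC: "yao_frame u DIM('a) UNIV (restr M B) c' CC" "refines_frame (restr M B) (Suc (t - 1)) CC P"
    and miss: "t - 1 \<le> card {K \<in> P. G \<inter> interior K = {}}"
    using add_center.IH[OF adm] by blast
  \<comment> \<open>The induction hypothesis yields only some frame of the restricted measure;
    uniqueness identifies it with the frame of \<open>R\<close>.\<close>
  have "CC = (\<lambda>(A, B). A \<union> B) ` R"
    using yao_frame_unique[OF u adm CC(1)]
      ab_partition_yao_frame(2)[OF u M R ab, folded add_center.hyps(3)] by blast
  \<comment> \<open>With \<open>t - 1\<close> centers, \<open>P\<close> has at least
    \<open>t\<close> regions in each cell, one more than its number of centers.\<close>
  moreover have t: "Suc (t - 1) = t" using add_center.hyps(1) by simp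
  ultimately have P: "refines_frame (restr M (\<Union> (snd ` R))) t ((\<lambda>(A, B). A \<union> B) ` R) P"
    using CC(2) add_center.hyps(3) by simp
  note add = add_center_regions[OF u M R ab P, folded add_center.hyps(3)]
  let ?Q = "fst ` R \<union> (\<lambda>K. K \<inter> B) ` P"
  have rf: "refines_frame M (Suc t) ((\<lambda>(A, B). A \<union> B) ` R) ?Q"
    using add_center_refines_frame[OF u M R ab P] unfolding add_center.hyps(3) .
  have finP: "finite P" using refines_frame_finite[OF P] .
  have finQ: "finite {K \<in> ?Q. G \<inter> interior K = {}}" using refines_frame_finite[OF rf] by simp
  have "t \<le> card {K \<in> ?Q. G \<inter> interior K = {}}"
    using ab_partition_hyperplane[OF u R G]
  proof
    assume "\<exists>(A, B)\<in>R. G \<inter> interior A = {}"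
    then obtain A1 B1 where AB: "(A1, B1) \<in> R" "G \<inter> interior A1 = {}" by blast
    \<comment> \<open>The traces of the \<open>t - 1\<close> missed regions are still missed, as
      their interiors only shrink; \<open>A1\<close> is the additional one.\<close>
    let ?S = "{K \<in> P. G \<inter> interior K = {}}"
    have "card ((\<lambda>K. K \<inter> B) ` ?S) = card ?S"
      by (rule card_image[OF inj_on_subset[OF add(2)]]) blast
    moreover have "A1 \<notin> (\<lambda>K. K \<inter> B) ` ?S"
    proof
      assume "A1 \<in> (\<lambda>K. K \<inter> B) ` ?S"
      then obtain K where "K \<in> P" "A1 = K \<inter> B" by blast
      then show False
        using add(5)[OF \<open>K \<in> P\<close> AB(1)] ab_partition_regions(3)[OF u M R ab AB(1)] by simp
    qed
    ultimately have "card (insert A1 ((\<lambda>K. K \<inter> B) ` ?S)) = Suc (card ?S)"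
      using finP by simp
    then have "t \<le> card (insert A1 ((\<lambda>K. K \<inter> B) ` ?S))" using miss t by linarith
    also have "\<dots> \<le> card {K \<in> ?Q. G \<inter> interior K = {}}"
    proof (rule card_mono[OF finQ])
      have "A1 \<in> fst ` R" using AB(1) by (rule image_eqI[rotated]) simp
      moreover have "G \<inter> interior (K \<inter> B) = {}" if "K \<in> ?S" for K
        using that interior_mono[of "K \<inter> B" K] by blast
      ultimately show "insert A1 ((\<lambda>K. K \<inter> B) ` ?S) \<subseteq> {K \<in> ?Q. G \<inter> interior K = {}}"
        using AB(2) by (intro insert_subsetI image_subsetI CollectI conjI) simp_all
    qed
    finally show ?thesis .
  next
    assume "\<exists>(A, B)\<in>R. G \<inter> interior B = {}"
    then obtain A1 B1 where AB: "(A1, B1) \<in> R" "G \<inter> interior B1 = {}" by blast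
    \<comment> \<open>All regions of \<open>P\<close> in this cell count here, even those that the
      hyperplane meets: their traces lie in \<open>B1\<close>, whose interior is missed.\<close>
    let ?S = "{K \<in> P. K \<subseteq> A1 \<union> B1}"
    have "A1 \<union> B1 \<in> (\<lambda>(A, B). A \<union> B) ` R"
      using AB(1) by (intro image_eqI[of _ _ "(A1, B1)"]) auto
    then have "t \<le> card ?S" by (rule refines_frame_card[OF P])
    also have "card ?S = card ((\<lambda>K. K \<inter> B) ` ?S)"
      by (rule card_image[symmetric, OF inj_on_subset[OF add(2)]]) blast
    also have "\<dots> \<le> card {K \<in> ?Q. G \<inter> interior K = {}}"
    proof (rule card_mono[OF finQ])
      have "G \<inter> interior (K \<inter> B) = {}" if "K \<in> ?S" for K
      proof -
        have "K \<inter> B = K \<inter> B1"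
          using ab_partition_Int_Union_snd[OF u R AB(1), of K] that add_center.hyps(3) by simp
        then show ?thesis using interior_mono[of "K \<inter> B1" B1] AB(2) by auto
      qed
      then show "(\<lambda>K. K \<inter> B) ` ?S \<subseteq> {K \<in> ?Q. G \<inter> interior K = {}}"
        by (intro image_subsetI CollectI conjI) simp_all
    qed
    finally show ?thesis .
  qed
  then show ?case
    unfolding add(1) using rf ab_partition_yao_frame(1)[OF u M R ab] by blast
qed

lemma abs_cont_measure_admissible:
  assumes "finite_measure M" "abs_cont_measure M"
  shows "admissible u M"
proof -
  interpret finite_measure M by fact
  show ?thesis using assms
    by (auto simp: admissible_def abs_cont_measure_def emeasure_eq_measure zero_less_measure_iff)
qed

theorem theorem3p1:
  fixes u :: "nat \<Rightarrow> 'a::euclidean_space" and \<mu> :: "'a measure"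
    and t :: nat and P :: "'a set set" and G :: "'a set"
  assumes "orthonormal_basis u"
    and "finite_measure \<mu>"
    and "abs_cont_measure \<mu>"
    and "multicenter_partition u t \<mu> P"
    and "is_hyperplane G"
  shows "t \<le> card {K \<in> P. G \<inter> interior K = {}}"
  using multicenter_partition_frame_hyperplane[OF assms(1,5,4) abs_cont_measure_admissible[OF assms(2,3)]]
  by blast

end
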